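(* Let $1\le p,q\le\infty$ with $\frac1p+\frac1q=1$. Let $\mathcal P_N$ be the initial segment, consisting of the first $N$ terms, of a digital $((t_{\mathfrak u})_{\emptyset\ne\mathfrak u\subseteq[s]},s)$-sequence over $\mathbb{F}_2$. Assume that the generating matrices $C_1,\ldots,C_s$ are non-singular upper triangular matrices. Then for any $N\in\mathbb{N}$ with $N\ge2$ we have $$\mathrm{wce}(\mathcal P_N;p,s,\boldsymbol\gamma,\varphi)\le\frac1N\,\frac{3\log(2N)}{\log2}\left(\sum_{\emptyset\ne\mathfrak u\subseteq[s]}\left(\gamma_{\mathfrak u}\,2^{t_{\mathfrak u}}\,(3\log N)^{|\mathfrak u|}\prod_{i\in\mathfrak u}(b_i-a_i)\right)^q\right)^{1/q}$$ (for $q=\infty$ the $\ell_q$-sum over $\mathfrak u$ is replaced by the maximum over $\mathfrak u$), where $\log$ is the natural logarithm.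
   Context: Setting. Let $s\in\mathbb{N}$, $[s]=\{1,\ldots,s\}$, $-\infty<a_i<b_i<\infty$ for $i\in[s]$, $[\boldsymbol a,\boldsymbol b]=\prod_{i=1}^s[a_i,b_i]$. For each $i$ let $\varphi_i:[a_i,b_i]\to\mathbb{R}$ be a probability density function with respect to Lebesgue measure, $\varphi(\boldsymbol x)=\prod_{i=1}^s\varphi_i(x_i)$, and let $\Phi_i(x)=\int_{a_i}^x\varphi_i(y)\,\mathrm{d}y$, which is assumed to be invertible as a map $[a_i,b_i]\to[0,1]$. Put $\Phi^{-1}(\boldsymbol x)=(\Phi_1^{-1}(x_1),\ldots,\Phi_s^{-1}(x_s))$ for $\boldsymbol x\in[0,1]^s$. Let $\boldsymbol\gamma=\{\gamma_{\mathfrak u}:\mathfrak u\subseteq[s]\}$ be positive real numbers (weights). Norm. For $\mathfrak u=\{u_1<\cdots<u_k\}\subseteq[s]$ let $\frac{\partial^{|\mathfrak u|}F}{\partial\boldsymbol x_{\mathfrak u}}=\frac{\partial^kF}{\partial x_{u_1}\cdots\partial x_{u_k}}$ (equal to $F$ for $\mathfrak u=\emptyset$). For functions $F:[\boldsymbol a,\boldsymbol b]\to\mathbb{R}$ for which these mixed partial derivatives exist, and $p\in[1,\infty]$, let $\|F\|_{p,s,\boldsymbol\gamma}=\left(\sum_{\mathfrak u\subseteq[s]}\left(\frac1{\gamma_{\mathfrak u}}\sup_{\boldsymbol x\in[\boldsymbol a,\boldsymbol b]}\left|\frac{\partial^{|\mathfrak u|}F}{\partial\boldsymbol x_{\mathfrak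 u}}(\boldsymbol x)\right|\right)^p\right)^{1/p}$, with the maximum over $\mathfrak u$ if $p=\infty$. Worst-case error. For points $\mathcal P=\{\boldsymbol y_0,\ldots,\boldsymbol y_{N-1}\}$ in $[0,1]^s$ let $\mathrm{err}(F;\varphi;\mathcal P)=\frac1N\sum_{n=0}^{N-1}F(\Phi^{-1}(\boldsymbol y_n))-\int_{[\boldsymbol a,\boldsymbol b]}F(\boldsymbol x)\varphi(\boldsymbol x)\,\mathrm d\boldsymbol x$ and $\mathrm{wce}(\mathcal P;p,s,\boldsymbol\gamma,\varphi)=\sup_{\|F\|_{p,s,\boldsymbol\gamma}\le1}|\mathrm{err}(F;\varphi;\mathcal P)|$. Digital net condition. For $m\ge1$ and an integer $0\le t\le m$, $m\times m$ matrices $A_1,\ldots,A_d$ over $\mathbb{F}_2$ are said to generate a digital $(t,m,d)$-net over $\mathbb{F}_2$ if for all non-negative integers $d_1,\ldots,d_d$ with $d_1+\cdots+d_d=m-t$ the system consisting of the first $d_1$ rows of $A_1$, ..., the first $d_d$ rows of $A_d$ is linearly independent over $\mathbb{F}_2$. Digital sequences. Let $C_1,\ldots,C_s\in\mathbb{F}_2^{\mathbb{N}\times\mathbb{N}}$, $C_i=(c_{i,k,\ell})_{k,\ell\in\mathbb{N}}$, be such that for each $\ell$ there is $K(\ell)\in\mathbb{N}$ with $c_{i,k,\ell}=0$ for all $k>K(\ell)$. For $n\in\mathbb{N}_0$ with binary digits $n=n_0+n_12+\cdots+n_{m-1}2^{m-1}$ put $\vec n=(n_0,\ldots,n_{m-1},0,0,\ldots)^\top\in\mathbb{F}_2^{\mathbb{N}}$,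 $C_i\vec n=(y_1^{(i)},y_2^{(i)},\ldots)^\top$ (over $\mathbb{F}_2$), $x_n^{(i)}=\sum_{k\ge1}y_k^{(i)}2^{-k}$, $\boldsymbol x_n=(x_n^{(1)},\ldots,x_n^{(s)})$. The sequence $(\boldsymbol x_n)_{n\ge0}$ is a digital $(t,s)$-sequence over $\mathbb{F}_2$ with generating matrices $C_1,\ldots,C_s$ if for every $m\ge t$ (with $m\ge1$) the upper left $m\times m$ submatrices of $C_1,\ldots,C_s$ generate a digital $(t,m,s)$-net over $\mathbb{F}_2$. It is a digital $((t_{\mathfrak u})_{\emptyset\ne\mathfrak u\subseteq[s]},s)$-sequence if for every $\emptyset\neq\mathfrak u\subseteq[s]$ the matrices $(C_i)_{i\in\mathfrak u}$ generate a digital $(t_{\mathfrak u},|\mathfrak u|)$-sequence over $\mathbb{F}_2$. A matrix in $\mathbb{F}_2^{\mathbb{N}\times\mathbb{N}}$ is non-singular upper triangular if its entries below the diagonal are $0$ and all its diagonal entries are $1$. *)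

theory Defs
  imports "HOL-Analysis.Analysis" "HOL-Library.Z2"
begin

text \<open>
  Points of \<open>\<real>\<^sup>I\<close>, for a finite set \<open>I\<close> of coordinates, are functions \<open>nat \<Rightarrow> real\<close> that are
  extensional on \<open>I\<close>.
\<close>

definition box_on :: "nat set \<Rightarrow> (nat \<Rightarrow> real) \<Rightarrow> (nat \<Rightarrow> real) \<Rightarrow> (nat \<Rightarrow> real) set" where
  "box_on I a b = (\<Pi>\<^sub>E i\<in>I. {a i..b i})"


subsection \<open>Product densities\<close>

definition density_on :: "real \<Rightarrow> real \<Rightarrow> (real \<Rightarrow> real) \<Rightarrow> bool" where
  "density_on l r f \<longleftrightarrow>
     (\<forall>x\<in>{l..r}. 0 \<le> f x) \<and>
     integrable (lebesgue_on {l..r}) f \<and> integral\<^sup>L (lebesgue_on {l..r}) f = 1"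

definition cdf_on :: "real \<Rightarrow> (real \<Rightarrow> real) \<Rightarrow> real \<Rightarrow> real" where
  "cdf_on l f x = integral\<^sup>L (lebesgue_on {l..x}) f"

definition inv_cdf_map ::
    "nat set \<Rightarrow> (nat \<Rightarrow> real) \<Rightarrow> (nat \<Rightarrow> real) \<Rightarrow> (nat \<Rightarrow> real \<Rightarrow> real) \<Rightarrow> (nat \<Rightarrow> real) \<Rightarrow> nat \<Rightarrow> real" where
  "inv_cdf_map I a b \<phi> y = (\<lambda>i\<in>I. inv_into {a i..b i} (cdf_on (a i) (\<phi> i)) (y i))"


subsection \<open>Mixed partial derivatives and the weighted norm\<close>

text \<open>Derivatives are taken within the box, hence are one-sided on its faces.\<close>

definition partial_deriv ::
    "(nat \<Rightarrow> real) \<Rightarrow> (nat \<Rightarrow> real) \<Rightarrow> nat \<Rightarrow> ((nat \<Rightarrow> real) \<Rightarrow> real) \<Rightarrow> (nat \<Rightarrow> real) \<Rightarrow> real" where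
  "partial_deriv a b i F x =
     vector_derivative (\<lambda>\<xi>. F (x(i := \<xi>))) (at (x i) within {a i..b i})"

text \<open>
  For \<open>u = {u\<^sub>1 < \<dots> < u\<^sub>k}\<close> this is \<open>\<partial>\<^sub>u\<^sub>1 (\<partial>\<^sub>u\<^sub>2 (\<dots> (\<partial>\<^sub>u\<^sub>k F)))\<close>: the largest coordinate is differentiated
  first.
\<close>

definition mixed_partial ::
    "(nat \<Rightarrow> real) \<Rightarrow> (nat \<Rightarrow> real) \<Rightarrow> nat set \<Rightarrow> ((nat \<Rightarrow> real) \<Rightarrow> real) \<Rightarrow> (nat \<Rightarrow> real) \<Rightarrow> real" where
  "mixed_partial a b u F = foldr (partial_deriv a b) (sorted_list_of_set u) F"

text \<open>
  All mixed partial derivatives exist everywhere on the box: each of them arises from some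
  \<open>mixed_partial a b u F\<close> by one further derivative in a coordinate below \<open>u\<close>.
\<close>

definition has_mixed_partials ::
    "nat set \<Rightarrow> (nat \<Rightarrow> real) \<Rightarrow> (nat \<Rightarrow> real) \<Rightarrow> ((nat \<Rightarrow> real) \<Rightarrow> real) \<Rightarrow> bool" where
  "has_mixed_partials I a b F \<longleftrightarrow>
     (\<forall>u i. u \<subseteq> I \<longrightarrow> i \<in> I \<longrightarrow> (\<forall>j\<in>u. i < j) \<longrightarrow>
        (\<forall>x\<in>box_on I a b.
           (\<lambda>\<xi>. mixed_partial a b u F (x(i := \<xi>))) differentiable (at (x i) within {a i..b i})))"

definition lp_norm_on :: "ereal \<Rightarrow> 'a set \<Rightarrow> ('a \<Rightarrow> real) \<Rightarrow> real" where
  "lp_norm_on p A c =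
     (if p = \<infinity> then Max ((\<lambda>u. \<bar>c u\<bar>) ` A)
      else (\<Sum>u\<in>A. \<bar>c u\<bar> powr real_of_ereal p) powr (1 / real_of_ereal p))"

text \<open>
  The suprema may be infinite, in which case so is the norm; the real-valued supremum is
  meaningful only for a bounded derivative.
\<close>

definition mixed_norm ::
    "ereal \<Rightarrow> nat set \<Rightarrow> (nat set \<Rightarrow> real) \<Rightarrow> (nat \<Rightarrow> real) \<Rightarrow> (nat \<Rightarrow> real) \<Rightarrow>
     ((nat \<Rightarrow> real) \<Rightarrow> real) \<Rightarrow> ereal" where
  "mixed_norm p I \<gamma> a b F =
     (if \<forall>u\<subseteq>I. bdd_above ((\<lambda>x. \<bar>mixed_partial a b u F x\<bar>) ` box_on I a b)
      then ereal (lp_norm_on p (Pow I)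
             (\<lambda>u. (1 / \<gamma> u) * (SUP x\<in>box_on I a b. \<bar>mixed_partial a b u F x\<bar>)))
      else \<infinity>)"


subsection \<open>Quadrature error and worst-case error\<close>

text \<open>
  The point set is given as a sequence \<open>y\<close>, of which the first \<open>N\<close> terms are used, counted with
  multiplicity. The integral is over the product of the one-dimensional Lebesgue measures on
  \<open>{a i..b i}\<close>. This product is not completed, which does not affect the worst-case error:
  functions of finite norm are Lipschitz on the box, so the integrands below are measurable
  for it.
\<close>

definition quad_err ::
    "nat set \<Rightarrow> (nat \<Rightarrow> real) \<Rightarrow> (nat \<Rightarrow> real) \<Rightarrow> (nat \<Rightarrow> real \<Rightarrow> real) \<Rightarrow> (nat \<Rightarrow> nat \<Rightarrow> real) \<Rightarrow> nat \<Rightarrow>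
     ((nat \<Rightarrow> real) \<Rightarrow> real) \<Rightarrow> real" where
  "quad_err I a b \<phi> y N F =
     (1 / real N) * (\<Sum>n<N. F (inv_cdf_map I a b \<phi> (y n)))
     - (LINT x|(\<Pi>\<^sub>M i\<in>I. lebesgue_on {a i..b i}). F x * (\<Prod>i\<in>I. \<phi> i (x i)))"

definition wce ::
    "(nat \<Rightarrow> nat \<Rightarrow> real) \<Rightarrow> nat \<Rightarrow> ereal \<Rightarrow> nat set \<Rightarrow> (nat set \<Rightarrow> real) \<Rightarrow>
     (nat \<Rightarrow> real) \<Rightarrow> (nat \<Rightarrow> real) \<Rightarrow> (nat \<Rightarrow> real \<Rightarrow> real) \<Rightarrow> ereal" where
  "wce y N p I \<gamma> a b \<phi> =
     (SUP F \<in> {F. has_mixed_partials I a b F \<and> mixed_norm p I \<gamma> a b F \<le> 1}.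
        ereal \<bar>quad_err I a b \<phi> y N F\<bar>)"


subsection \<open>Digital nets and sequences over \<open>\<bbbF>\<^sub>2\<close>\<close>

text \<open>
  The field \<open>\<bbbF>\<^sub>2\<close> is the type \<^typ>\<open>bit\<close>. Rows and columns of matrices are numbered from 0, so that
  \<open>C k l\<close> is the entry in row \<open>k + 1\<close> and column \<open>l + 1\<close> in the usual numbering. An \<open>m \<times> m\<close> matrix is
  given by its entries \<open>A k l\<close> with \<open>k, l < m\<close>; the other entries are ignored, so an infinite matrix
  also stands for its upper left \<open>m \<times> m\<close> submatrix.

  Linear independence is that of a family (a repeated row makes it dependent). It is stated for
  the first \<open>d i\<close> rows, truncated to length \<open>m\<close>, of the matrices \<open>A i\<close>.
\<close>

definition rows_lin_indep :: "nat set \<Rightarrow> nat \<Rightarrow> (nat \<Rightarrow> nat) \<Rightarrow> (nat \<Rightarrow> nat \<Rightarrow> nat \<Rightarrow> bit) \<Rightarrow> bool" where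
  "rows_lin_indep I m d A \<longleftrightarrow>
     (\<forall>\<kappa> :: nat \<Rightarrow> nat \<Rightarrow> bit.
        (\<forall>l<m. (\<Sum>i\<in>I. \<Sum>k<d i. \<kappa> i k * A i k l) = 0) \<longrightarrow> (\<forall>i\<in>I. \<forall>k<d i. \<kappa> i k = 0))"

definition digital_net :: "nat set \<Rightarrow> nat \<Rightarrow> nat \<Rightarrow> (nat \<Rightarrow> nat \<Rightarrow> nat \<Rightarrow> bit) \<Rightarrow> bool" where
  "digital_net I t m A \<longleftrightarrow>
     1 \<le> m \<and> t \<le> m \<and> (\<forall>d. (\<Sum>i\<in>I. d i) = m - t \<longrightarrow> rows_lin_indep I m d A)"

definition column_finite :: "(nat \<Rightarrow> nat \<Rightarrow> bit) \<Rightarrow> bool" where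
  "column_finite C \<longleftrightarrow> (\<forall>l. \<exists>K. \<forall>k>K. C k l = 0)"

definition binary_digit :: "nat \<Rightarrow> nat \<Rightarrow> bit" where
  "binary_digit n l = of_nat (n div 2 ^ l)"

text \<open>
  The digits of \<open>C\<close> times the digit vector of \<open>n\<close>; columns \<open>l \<ge> n\<close> do not contribute because
  \<open>n < 2 ^ n\<close>.
\<close>

definition mat_digit :: "(nat \<Rightarrow> nat \<Rightarrow> bit) \<Rightarrow> nat \<Rightarrow> nat \<Rightarrow> bit" where
  "mat_digit C n k = (\<Sum>l<n. C k l * binary_digit n l)"

definition digital_coord :: "(nat \<Rightarrow> nat \<Rightarrow> bit) \<Rightarrow> nat \<Rightarrow> real" where
  "digital_coord C n = (\<Sum>k. of_bool (mat_digit C n k = 1) / 2 ^ Suc k)"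

definition digital_points :: "nat set \<Rightarrow> (nat \<Rightarrow> nat \<Rightarrow> nat \<Rightarrow> bit) \<Rightarrow> nat \<Rightarrow> nat \<Rightarrow> real" where
  "digital_points I C n = (\<lambda>i\<in>I. digital_coord (C i) n)"

definition digital_sequence ::
    "nat set \<Rightarrow> nat \<Rightarrow> (nat \<Rightarrow> nat \<Rightarrow> nat \<Rightarrow> bit) \<Rightarrow> (nat \<Rightarrow> nat \<Rightarrow> real) \<Rightarrow> bool" where
  "digital_sequence I t C x \<longleftrightarrow>
     (\<forall>i\<in>I. column_finite (C i)) \<and>
     x = digital_points I C \<and>
     (\<forall>m\<ge>t. 1 \<le> m \<longrightarrow> digital_net I t m C)"

definition digital_sequence_family ::
    "nat set \<Rightarrow> (nat set \<Rightarrow> nat) \<Rightarrow> (nat \<Rightarrow> nat \<Rightarrow> nat \<Rightarrow> bit) \<Rightarrow> (nat \<Rightarrow> nat \<Rightarrow> real) \<Rightarrow> bool" where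
  "digital_sequence_family I t C x \<longleftrightarrow>
     x = digital_points I C \<and>
     (\<forall>u\<subseteq>I. u \<noteq> {} \<longrightarrow> digital_sequence u (t u) C (\<lambda>n. restrict (x n) u))"

definition nonsingular_upper_triangular :: "(nat \<Rightarrow> nat \<Rightarrow> bit) \<Rightarrow> bool" where
  "nonsingular_upper_triangular C \<longleftrightarrow> (\<forall>k l. l < k \<longrightarrow> C k l = 0) \<and> (\<forall>k. C k k = 1)"

end

theory Submission
  imports Defs
begin

text \<open>
  Let \<open>G = F \<circ> \<Phi>\<inverse>\<close>. By iterated use of the mean value theorem, the mixed difference of \<open>G\<close> over a cell
  of a grid is at most \<open>sup \<bar>\<partial>\<^sub>u F\<bar>\<close> times the volume of the image of the cell under \<open>\<Phi>\<inverse>\<close>. These volumes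
  add up to \<open>\<Prod>i\<in>u. b i - a i\<close>, whatever the density is. Summation by parts on finer and finer grids
  therefore gives a Koksma-Hlawka inequality for the weighted integral, with the star discrepancies of
  the projections of the points, and no regularity of \<open>\<partial>\<^sub>u F\<close> beyond boundedness is needed. Hoelder's
  inequality for the sum over \<open>u\<close> produces the two norms.

  For the star discrepancy, the binary expansion of \<open>N\<close> splits the first \<open>N\<close> points into at most
  \<open>log\<^sub>2 (2 N)\<close> blocks of the form \<open>K 2 ^ m \<le> n < (K + 1) 2 ^ m\<close>. A character sum over the block shows
  that every elementary interval of volume at least \<open>2 ^ (t - m)\<close> contains exactly the expected number
  of its points, and approximating a box by such intervals costs at most \<open>2 ^ t (m + 1) ^ card u\<close> points.
\<close>

subsection \<open>Characters and digit patterns\<close>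

text \<open>Sums and products of bits are kept as field operations; as XOR and AND they would escape
  the rules for rings and finite sums.\<close>

declare add_bit_eq_xor [simp del] mult_bit_eq_and [simp del]

text \<open>The nontrivial additive character of the field with two elements.\<close>

definition bit_sign :: "bit \<Rightarrow> real" where
  "bit_sign b = (if b = 0 then 1 else - 1)"

lemma bit_sign_0 [simp]: "bit_sign 0 = 1" and bit_sign_1 [simp]: "bit_sign 1 = - 1"
  by (simp_all add: bit_sign_def)

lemma bit_sign_add: "bit_sign (x + y) = bit_sign x * bit_sign y"
  by (cases x; cases y) (simp_all add: bit_sign_def)

lemma bit_sign_sum: "bit_sign (sum f A) = (\<Prod>x\<in>A. bit_sign (f x))"
  by (induction A rule: infinite_finite_induct) (simp_all add: bit_sign_add)

text \<open>Averaging the two characters detects \<open>x + y = 0\<close>, which over two elements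
  means \<open>x = y\<close>. This turns counting points into character sums.\<close>

lemma of_bool_bit_eq: "of_bool (x = y) = (1 + bit_sign (x + y)) / (2::real)"
  by (cases x; cases y) (simp_all add: bit_sign_def)

lemma of_bool_ball_eq_prod: "finite A \<Longrightarrow> of_bool (\<forall>x\<in>A. P x) = (\<Prod>x\<in>A. of_bool (P x) :: real)"
  by (induction A rule: finite_induct) auto

lemma of_nat_bit: "(of_nat n :: bit) = of_bool (odd n)"
  by (induction n) auto

section \<open>Binary digits and matrix digits on a block of indices\<close>

lemma binary_digit_shift_low:
  assumes "l < m"
  shows "binary_digit (K * 2 ^ m + v) l = binary_digit v l"
proof -
  \<comment> \<open>\<open>K * 2 ^ m\<close> is an even multiple of \<open>2 ^ l\<close>, so it does
    not change the parity of the quotient.\<close>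
  have "K * 2 ^ m + v = v + (2 * K * 2 ^ (m - Suc l)) * 2 ^ l"
    using assms by (simp flip: power_add power_Suc)
  then have "(K * 2 ^ m + v) div 2 ^ l = 2 * K * 2 ^ (m - Suc l) + v div 2 ^ l"
    by (metis add.commute div_mult_self1 power_not_zero zero_neq_numeral)
  then show ?thesis
    by (simp add: binary_digit_def of_nat_bit)
qed

lemma binary_digit_shift_high:
  assumes "v < 2 ^ m"
  shows "binary_digit (K * 2 ^ m + v) (m + l) = binary_digit K l"
  using assms by (simp add: binary_digit_def power_add div_mult2_eq)

lemma binary_digit_eq_0: "n < 2 ^ l \<Longrightarrow> binary_digit n l = 0"
  by (simp add: binary_digit_def)

text \<open>All digits of \<open>n\<close> from position \<open>n\<close> on vanish because
  \<open>n < 2 ^ n\<close>, so the number of columns may be enlarged to suit a later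
  splitting.\<close>

lemma mat_digit_eq_sum:
  assumes "n \<le> L"
  shows "mat_digit C n k = (\<Sum>l<L. C k l * binary_digit n l)"
  unfolding mat_digit_def
proof (rule sum.mono_neutral_left)
  show "\<forall>l\<in>{..<L} - {..<n}. C k l * binary_digit n l = 0"
  proof
    fix l assume "l \<in> {..<L} - {..<n}"
    then have "n < 2 ^ l"
      using less_le_trans[OF less_exp[of n] power_increasing[of n l "2::nat"]] by auto
    then show "C k l * binary_digit n l = 0"
      by (simp add: binary_digit_eq_0)
  qed
qed (use assms in auto)

lemma sum_lessThan_add: "(\<Sum>l<m + n. f l) = (\<Sum>l<m. f l) + (\<Sum>l<n. f (m + l) :: 'a :: comm_monoid_add)"
  for m n :: nat
  by (induction n) (simp_all add: add.assoc)

text \<open>On a block, the first \<open>m\<close> columns see only \<open>v\<close> and the others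
  only \<open>K\<close>. The digits are thus those of a linear map of \<open>v\<close>, shifted by a
  vector that is constant on the block.\<close>

lemma mat_digit_block:
  assumes "v < 2 ^ m"
  shows "mat_digit C (K * 2 ^ m + v) k =
    (\<Sum>l<m. C k l * binary_digit v l) + mat_digit (\<lambda>k l. C k (m + l)) K k"
proof -
  let ?n = "K * 2 ^ m + v"
  \<comment> \<open>The range \<open>m + ?n\<close> can be split at \<open>m\<close> even if
    \<open>?n < m\<close>.\<close>
  have "mat_digit C ?n k = (\<Sum>l<m + ?n. C k l * binary_digit ?n l)"
    by (rule mat_digit_eq_sum) simp
  also have "\<dots> = (\<Sum>l<m. C k l * binary_digit ?n l) + (\<Sum>l<?n. C k (m + l) * binary_digit ?n (m + l))"
    by (rule sum_lessThan_add)
  also have "(\<Sum>l<m. C k l * binary_digit ?n l) = (\<Sum>l<m. C k l * binary_digit v l)"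
    by (intro sum.cong) (simp_all add: binary_digit_shift_low)
  also have "(\<Sum>l<?n. C k (m + l) * binary_digit ?n (m + l)) = (\<Sum>l<?n. C k (m + l) * binary_digit K l)"
    by (intro sum.cong) (simp_all add: binary_digit_shift_high assms)
  also have "\<dots> = mat_digit (\<lambda>k l. C k (m + l)) K k"
    by (rule mat_digit_eq_sum[symmetric]) (simp add: trans_le_add1)
  finally show ?thesis .
qed

text \<open>Orthogonality of characters: the digits of \<open>v\<close> range independently, so the
  sum factorises. The product is 0 as soon as one \<open>r l\<close> is 1, and \<open>2 ^ m\<close>
  otherwise.\<close>

lemma sum_bit_sign_linear:
  "(\<Sum>v<2 ^ m. bit_sign (\<Sum>l<m. r l * binary_digit v l)) = (\<Prod>l<m. 1 + bit_sign (r l))"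
proof (induction m)
  case (Suc m)
  let ?f = "\<lambda>v. bit_sign (\<Sum>l<m. r l * binary_digit v l)"
  have "(\<Sum>v<2 ^ Suc m. bit_sign (\<Sum>l<Suc m. r l * binary_digit v l)) =
    (\<Sum>v<2 ^ Suc m. ?f v * bit_sign (r m * binary_digit v m))"
    by (simp add: bit_sign_add)
  \<comment> \<open>The range is split by the digit in position \<open>m\<close>, which is 0 on the
    lower half and 1 on the upper half.\<close>
  also have "\<dots> = (\<Sum>v<2 ^ m. ?f v * bit_sign (r m * binary_digit v m)) +
    (\<Sum>v<2 ^ m. ?f (1 * 2 ^ m + v) * bit_sign (r m * binary_digit (1 * 2 ^ m + v) m))"
    using sum_lessThan_add[of _ "2 ^ m" "2 ^ m"] by (simp add: mult_2)
  also have "(\<Sum>v<2 ^ m. ?f v * bit_sign (r m * binary_digit v m)) = (\<Sum>v<2 ^ m. ?f v)"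
    by (intro sum.cong) (simp_all add: binary_digit_eq_0)
  also have "(\<Sum>v<2 ^ m. ?f (1 * 2 ^ m + v) * bit_sign (r m * binary_digit (1 * 2 ^ m + v) m)) =
    (\<Sum>v<2 ^ m. ?f v * bit_sign (r m))"
  proof (intro sum.cong refl)
    fix v :: nat assume "v \<in> {..<2 ^ m}"
    then have "binary_digit (1 * 2 ^ m + v) (m + 0) = binary_digit 1 0"
      by (intro binary_digit_shift_high) simp
    then have *: "binary_digit (1 * 2 ^ m + v) m = 1"
      by (simp add: binary_digit_def)
    have "?f (1 * 2 ^ m + v) = ?f v"
      by (intro arg_cong[of _ _ bit_sign] sum.cong refl arg_cong2[of _ _ _ _ "(*)"] binary_digit_shift_low) auto
    then show "?f (1 * 2 ^ m + v) * bit_sign (r m * binary_digit (1 * 2 ^ m + v) m) = ?f v * bit_sign (r m)"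
      using * by simp
  qed
  finally show ?case
    by (simp only: sum_distrib_right[symmetric] Suc prod.lessThan_Suc) (simp add: algebra_simps)
qed simp

text \<open>Each prescribed digit contributes a factor \<open>(1 + character) / 2\<close>. Expanding
  the product gives one character for each set \<open>S\<close> of prescribed positions. By
  independence the rows in a nonempty \<open>S\<close> have a nonzero sum, so that its character
  sums to 0 over the block, and only \<open>S = {}\<close> remains.\<close>

lemma sum_digit_pattern:
  assumes "finite I" and indep: "rows_lin_indep I m d C"
  shows "(\<Sum>v<2 ^ m. of_bool (\<forall>i\<in>I. \<forall>k<d i. mat_digit (C i) (K * 2 ^ m + v) k = e i k)) =
    (2 ^ m / 2 ^ (\<Sum>i\<in>I. d i) :: real)"
proof -
  define J where "J = Sigma I (\<lambda>i. {..<d i})"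
  have J: "finite J" "card J = (\<Sum>i\<in>I. d i)"
    using assms by (auto simp: J_def)
  define g where "g x v = bit_sign (mat_digit (C (fst x)) (K * 2 ^ m + v) (snd x) + e (fst x) (snd x))"
    for x :: "nat \<times> nat" and v
  \<comment> \<open>The part of the sign \<open>g\<close> that depends on \<open>K\<close> and the
    pattern but not on \<open>v\<close>.\<close>
  define c where "c x = bit_sign (mat_digit (\<lambda>k l. C (fst x) k (m + l)) K (snd x) + e (fst x) (snd x))"
    for x :: "nat \<times> nat"
  have "of_bool (\<forall>i\<in>I. \<forall>k<d i. mat_digit (C i) (K * 2 ^ m + v) k = e i k) =
     (\<Sum>S\<in>Pow J. \<Prod>x\<in>S. g x v) / (2 ^ (\<Sum>i\<in>I. d i) :: real)" for v
  proof -
    have "of_bool (\<forall>i\<in>I. \<forall>k<d i. mat_digit (C i) (K * 2 ^ m + v) k = e i k) =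
      (of_bool (\<forall>x\<in>J. mat_digit (C (fst x)) (K * 2 ^ m + v) (snd x) = e (fst x) (snd x)) :: real)"
      by (rule arg_cong[of _ _ of_bool]) (auto simp: J_def)
    also have "\<dots> = (\<Prod>x\<in>J. (g x v + 1) / 2)"
      unfolding of_bool_ball_eq_prod[OF J(1)] of_bool_bit_eq g_def by (simp add: add.commute)
    also have "\<dots> = (\<Prod>x\<in>J. g x v + 1) / 2 ^ card J"
      by (simp add: prod_dividef)
    also have "(\<Prod>x\<in>J. g x v + 1) = (\<Sum>S\<in>Pow J. \<Prod>x\<in>S. g x v)"
      using prod_add[OF J(1), of "\<lambda>x. g x v" "\<lambda>_. 1"] by simp
    finally show ?thesis
      by (simp add: J(2))
  qed
  then have "(\<Sum>v<2 ^ m. of_bool (\<forall>i\<in>I. \<forall>k<d i. mat_digit (C i) (K * 2 ^ m + v) k = e i k)) =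
     (\<Sum>S\<in>Pow J. \<Sum>v<2 ^ m. \<Prod>x\<in>S. g x v) / (2 ^ (\<Sum>i\<in>I. d i) :: real)"
    by (simp add: sum_divide_distrib[symmetric] sum.swap[of _ "{..<2 ^ m}"])
  also have "(\<Sum>S\<in>Pow J. \<Sum>v<2 ^ m. \<Prod>x\<in>S. g x v) = (\<Sum>S\<in>Pow J. if S = {} then 2 ^ m else 0)"
  proof (intro sum.cong refl)
    fix S assume S: "S \<in> Pow J"
    show "(\<Sum>v<2 ^ m. \<Prod>x\<in>S. g x v) = (if S = {} then 2 ^ m else 0)"
    proof (cases "S = {}")
      case False
      have "finite S" using S J(1) finite_subset by auto
      define r where "r l = (\<Sum>x\<in>S. C (fst x) (snd x) l)" for l
      have "\<exists>l<m. r l \<noteq> 0"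
      proof (rule ccontr)
        assume *: "\<not> (\<exists>l<m. r l \<noteq> 0)"
        \<comment> \<open>If the rows in \<open>S\<close> added up to 0, the indicator of
          \<open>S\<close> would be a nontrivial linear dependence.\<close>
        define \<kappa> :: "nat \<Rightarrow> nat \<Rightarrow> bit" where "\<kappa> i k = of_bool ((i, k) \<in> S)" for i k
        have "(\<Sum>i\<in>I. \<Sum>k<d i. \<kappa> i k * C i k l) = r l" for l
        proof -
          have "(\<Sum>i\<in>I. \<Sum>k<d i. \<kappa> i k * C i k l) = (\<Sum>x\<in>J. \<kappa> (fst x) (snd x) * C (fst x) (snd x) l)"
            unfolding J_def using assms(1) by (subst sum.Sigma) (auto simp: case_prod_unfold)
          also have "\<dots> = (\<Sum>x\<in>S. \<kappa> (fst x) (snd x) * C (fst x) (snd x) l)"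
            using S J(1) by (intro sum.mono_neutral_right) (auto simp: \<kappa>_def)
          also have "\<dots> = r l"
            unfolding r_def by (intro sum.cong) (auto simp: \<kappa>_def)
          finally show ?thesis .
        qed
        with * have "\<forall>l<m. (\<Sum>i\<in>I. \<Sum>k<d i. \<kappa> i k * C i k l) = 0"
          by auto
        with indep have "\<forall>i\<in>I. \<forall>k<d i. \<kappa> i k = 0"
          unfolding rows_lin_indep_def by blast
        moreover obtain x where "x \<in> S" using False by auto
        ultimately show False
          using S by (auto simp: J_def \<kappa>_def)
      qed
      then obtain l where l: "l < m" "r l = 1" by auto
      have "(\<Prod>x\<in>S. g x v) = (\<Prod>x\<in>S. c x) * bit_sign (\<Sum>l<m. r l * binary_digit v l)" if "v < 2 ^ m" for v
      proof -
        have "g x v = c x * bit_sign (\<Sum>l<m. C (fst x) (snd x) l * binary_digit v l)" for x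
          unfolding g_def c_def mat_digit_block[OF that] by (simp only: bit_sign_add mult_ac)
        moreover have "(\<Prod>x\<in>S. bit_sign (\<Sum>l<m. C (fst x) (snd x) l * binary_digit v l)) =
          bit_sign (\<Sum>l<m. r l * binary_digit v l)"
          unfolding r_def sum_distrib_right by (subst sum.swap) (simp only: bit_sign_sum)
        ultimately show ?thesis
          by (simp add: prod.distrib)
      qed
      then have "(\<Sum>v<2 ^ m. \<Prod>x\<in>S. g x v) = (\<Prod>x\<in>S. c x) * (\<Prod>l<m. 1 + bit_sign (r l))"
        by (simp add: sum_bit_sign_linear[symmetric] sum_distrib_left)
      also have "(\<Prod>l<m. 1 + bit_sign (r l)) = 0"
        using l by (intro prod_zero bexI[of _ l]) auto
      finally show ?thesis
        using False by simp
    qed simp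
  qed
  also have "\<dots> = 2 ^ m"
    using J(1) by (simp add: sum.delta)
  finally show ?thesis .
qed


text \<open>For an eventually zero \<open>e\<close>, this is the integer part of
  \<open>2 ^ d\<close> times the number with the binary digits \<open>e 0\<close>,
  \<open>e 1\<close>, ... after the point.\<close>

primrec digit_prefix :: "(nat \<Rightarrow> bit) \<Rightarrow> nat \<Rightarrow> nat" where
  "digit_prefix e 0 = 0"
| "digit_prefix e (Suc d) = 2 * digit_prefix e d + of_bool (e d = 1)"

lemma digit_prefix_add:
  "digit_prefix e d * 2 ^ j \<le> digit_prefix e (d + j)" "digit_prefix e (d + j) < (digit_prefix e d + 1) * 2 ^ j"
  by (induction j) (auto simp: algebra_simps)

lemma digit_prefix_eq_sum: "digit_prefix e d / 2 ^ d = (\<Sum>k<d. of_bool (e k = 1) / 2 ^ Suc k :: real)"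
  by (induction d) (auto simp: field_simps)

text \<open>The digits vanish from \<open>D\<close> on, so \<open>x\<close> is the prefix of length
  \<open>d + D\<close> over \<open>2 ^ (d + D)\<close>. This excludes a tail of ones, whence the
  strict upper bound.\<close>

lemma digit_prefix_bounds:
  fixes e :: "nat \<Rightarrow> bit"
  assumes "\<And>k. k \<ge> D \<Longrightarrow> e k = 0"
  defines "x \<equiv> (\<Sum>k. of_bool (e k = 1) / 2 ^ Suc k :: real)"
  shows "digit_prefix e d / 2 ^ d \<le> x" "x < (digit_prefix e d + 1) / 2 ^ d"
proof -
  have "x = (\<Sum>k<d + D. of_bool (e k = 1) / 2 ^ Suc k)"
    unfolding x_def using assms by (intro suminf_finite) auto
  then have x: "x = digit_prefix e (d + D) / 2 ^ (d + D)"
    by (simp only: digit_prefix_eq_sum)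
  have "real (digit_prefix e d * 2 ^ D) \<le> digit_prefix e (d + D)"
    by (subst of_nat_le_iff) (rule digit_prefix_add)
  then show "digit_prefix e d / 2 ^ d \<le> x"
    by (simp add: x power_add field_simps)
  have "real (digit_prefix e (d + D)) < real ((digit_prefix e d + 1) * 2 ^ D)"
    by (subst of_nat_less_iff) (rule digit_prefix_add)
  then show "x < (digit_prefix e d + 1) / 2 ^ d"
    by (simp add: x power_add field_simps)
qed

text \<open>The first digit is the most significant one, so \<open>e k\<close> has the weight
  \<open>2 ^ (d - Suc k)\<close> in the prefix.\<close>

lemma digit_prefix_eq_iff:
  "c < 2 ^ d \<Longrightarrow> digit_prefix e d = c \<longleftrightarrow> (\<forall>k<d. e k = of_bool (odd (c div 2 ^ (d - Suc k))))"
proof (induction d arbitrary: c)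
  case (Suc d)
  have "digit_prefix e (Suc d) = c \<longleftrightarrow> digit_prefix e d = c div 2 \<and> (e d = 1 \<longleftrightarrow> odd c)"
    unfolding digit_prefix.simps by (cases "e d = 1"; simp; presburger)
  also have "digit_prefix e d = c div 2 \<longleftrightarrow> (\<forall>k<d. e k = of_bool (odd (c div 2 div 2 ^ (d - Suc k))))"
    using Suc.prems by (intro Suc.IH) auto
  also have "\<dots> \<longleftrightarrow> (\<forall>k<d. e k = of_bool (odd (c div 2 ^ (Suc d - Suc k))))"
    by (intro all_cong arg_cong2[of _ _ _ _ "(=)"] refl)
      (simp add: div_mult2_eq[symmetric] Suc_diff_Suc flip: power_Suc)
  also have "(e d = 1 \<longleftrightarrow> odd c) \<longleftrightarrow> e d = of_bool (odd c)"
    by (cases "e d") auto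
  finally show ?case
    by (auto simp: less_Suc_eq)
qed simp

text \<open>The prefix and \<open>c\<close> are integers whose half-open intervals of length
  \<open>2 ^ - d\<close> both contain \<open>x\<close>, which forces them to be equal.\<close>

lemma digit_cell_iff:
  fixes e :: "nat \<Rightarrow> bit"
  assumes "\<And>k. k \<ge> D \<Longrightarrow> e k = 0" and "c < 2 ^ d"
  defines "x \<equiv> (\<Sum>k. of_bool (e k = 1) / 2 ^ Suc k :: real)"
  shows "real c / 2 ^ d \<le> x \<and> x < (real c + 1) / 2 ^ d \<longleftrightarrow>
    (\<forall>k<d. e k = of_bool (odd (c div 2 ^ (d - Suc k))))"
proof -
  note b = digit_prefix_bounds[of D e d, OF assms(1), folded x_def]
  have "real c / 2 ^ d \<le> x \<and> x < (real c + 1) / 2 ^ d \<longleftrightarrow> digit_prefix e d = c"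
  proof
    assume "real c / 2 ^ d \<le> x \<and> x < (real c + 1) / 2 ^ d"
    then have "real (digit_prefix e d) < real (c + 1)" "real c < real (digit_prefix e d + 1)"
      using b by (auto simp: field_simps)
    then show "digit_prefix e d = c"
      by linarith
  qed (use b in \<open>auto simp: add.commute\<close>)
  then show ?thesis
    using digit_prefix_eq_iff[OF assms(2)] by simp
qed

lemma mat_digit_finite:
  assumes "column_finite C"
  obtains D where "\<And>k. k \<ge> D \<Longrightarrow> mat_digit C n k = 0"
proof -
  obtain K where K: "\<And>l k. k > K l \<Longrightarrow> C k l = 0"
    using assms unfolding column_finite_def by metis
  have "mat_digit C n k = 0" if "k \<ge> Suc (\<Sum>l<n. K l)" for k
    unfolding mat_digit_def
  proof (rule sum.neutral, intro ballI)
    fix l assume "l \<in> {..<n}"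
    then have "K l \<le> (\<Sum>l<n. K l)"
      by (intro member_le_sum) auto
    then show "C k l * binary_digit n l = 0"
      using K[of l k] that by simp
  qed
  then show ?thesis ..
qed

lemma digital_coord_bounds:
  assumes "column_finite C"
  shows "0 \<le> digital_coord C n" "digital_coord C n < 1"
proof -
  obtain D where D: "\<And>k. k \<ge> D \<Longrightarrow> mat_digit C n k = 0"
    using mat_digit_finite[OF assms] by blast
  show "0 \<le> digital_coord C n" "digital_coord C n < 1"
    using digit_prefix_bounds[of D "mat_digit C n" 0] D by (auto simp: digital_coord_def)
qed

subsection \<open>Discrepancy of digital sequences\<close>

text \<open>The local discrepancy, not divided by the number of points and for any set
  \<open>B\<close> of indices, so that it is additive in \<open>B\<close>. The half-open boxes make
  it additive under cutting a box as well.\<close>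

definition box_disc :: "nat set \<Rightarrow> nat set \<Rightarrow> (nat \<Rightarrow> nat \<Rightarrow> real) \<Rightarrow> (nat \<Rightarrow> real) \<Rightarrow> (nat \<Rightarrow> real) \<Rightarrow> real" where
  "box_disc u B y l r =
    (\<Sum>n\<in>B. \<Prod>i\<in>u. of_bool (l i \<le> y n i \<and> y n i < r i) :: real) - real (card B) * (\<Prod>i\<in>u. r i - l i)"

lemma box_disc_cong:
  assumes "\<And>i. i \<in> u \<Longrightarrow> l i = l' i" "\<And>i. i \<in> u \<Longrightarrow> r i = r' i"
    "\<And>n i. n \<in> B \<Longrightarrow> i \<in> u \<Longrightarrow> y n i = y' n i"
  shows "box_disc u B y l r = box_disc u B y' l' r'"
  unfolding box_disc_def using assms by (intro arg_cong2[of _ _ _ _ "(-)"] arg_cong2[of _ _ _ _ "(*)"] sum.cong prod.cong) auto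

lemma box_disc_split:
  fixes l r :: "nat \<Rightarrow> real"
  assumes "finite u" "i \<in> u" "l i \<le> h" "h \<le> r i"
  shows "box_disc u B y l r = box_disc u B y l (r(i := h)) + box_disc u B y (l(i := h)) r"
proof -
  have *: "(\<Prod>j\<in>u. f j) = f i * (\<Prod>j\<in>u - {i}. f j)" for f :: "nat \<Rightarrow> real"
    using assms prod.remove by metis
  have "of_bool (l i \<le> y n i \<and> y n i < r i) =
      (of_bool (l i \<le> y n i \<and> y n i < h) + of_bool (h \<le> y n i \<and> y n i < r i) :: real)" for n
    using assms by auto
  then show ?thesis
    by (simp add: box_disc_def * sum.distrib algebra_simps)
qed

text \<open>The number of points and the expected number both lie between 0 and their values for the
  larger box, and these two values agree.\<close>

lemma box_disc_le:
  fixes l r r' :: "nat \<Rightarrow> real"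
  assumes "finite u" "box_disc u B y l r' = 0" "\<And>i. i \<in> u \<Longrightarrow> l i \<le> r i" "\<And>i. i \<in> u \<Longrightarrow> r i \<le> r' i"
  shows "\<bar>box_disc u B y l r\<bar> \<le> card B * (\<Prod>i\<in>u. r' i - l i)"
proof -
  let ?c = "\<lambda>r. (\<Sum>n\<in>B. \<Prod>i\<in>u. of_bool (l i \<le> y n i \<and> y n i < r i)) :: real"
  have "?c r \<le> ?c r'"
    using assms by (intro sum_mono prod_mono) (fastforce simp: of_bool_def)
  moreover have "0 \<le> ?c r"
    by (intro sum_nonneg prod_nonneg) auto
  moreover have "(\<Prod>i\<in>u. r i - l i) \<le> (\<Prod>i\<in>u. r' i - l i)"
    using assms by (intro prod_mono) auto
  then have "card B * (\<Prod>i\<in>u. r i - l i) \<le> card B * (\<Prod>i\<in>u. r' i - l i)"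
    by (intro mult_left_mono) auto
  moreover have "0 \<le> card B * (\<Prod>i\<in>u. r i - l i)"
    using assms by (intro mult_nonneg_nonneg prod_nonneg) auto
  ultimately show ?thesis
    using assms(2) unfolding box_disc_def by linarith
qed

text \<open>
  The coordinates in \<open>v\<close> are those whose elementary cell is cut by the boundary of the box. Bisecting
  such a cell leaves one cut half, while the other half is void or complete; once the cells
  have volume \<open>2 ^ - k\<close>, the number of points in the current cell bounds the error.
\<close>

lemma net_box_disc_cut:
  fixes z :: "nat \<Rightarrow> real" and y :: "nat \<Rightarrow> nat \<Rightarrow> real"
  assumes u: "finite u" and B: "card B = 2 ^ (t + k)"
    and elementary: "\<And>d c. (\<Sum>i\<in>u. d i) \<le> k \<Longrightarrow> (\<And>i. i \<in> u \<Longrightarrow> c i < 2 ^ d i) \<Longrightarrow>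
      box_disc u B y (\<lambda>i. real (c i) / 2 ^ d i) (\<lambda>i. (real (c i) + 1) / 2 ^ d i) = 0"
  shows "v \<subseteq> u \<Longrightarrow> (\<Sum>i\<in>u. d i) \<le> k \<Longrightarrow> (\<And>i. i \<in> u \<Longrightarrow> c i < 2 ^ d i) \<Longrightarrow>
    (\<And>i. i \<in> v \<Longrightarrow> real (c i) / 2 ^ d i \<le> z i \<and> z i \<le> (real (c i) + 1) / 2 ^ d i) \<Longrightarrow>
    \<bar>box_disc u B y (\<lambda>i. real (c i) / 2 ^ d i) (\<lambda>i. if i \<in> v then z i else (real (c i) + 1) / 2 ^ d i)\<bar>
      \<le> 2 ^ t * (real (k - (\<Sum>i\<in>u. d i)) + 1) ^ card v"
\<comment> \<open>Each bisection lowers \<open>k - (\<Sum>i\<in>u. d i)\<close> by one, and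
  \<open>card v\<close> never grows.\<close>
proof (induction "card v + (k - (\<Sum>i\<in>u. d i))" arbitrary: v d c rule: less_induct)
  case less
  note prems = less.prems
  have v: "finite v" using u prems finite_subset by blast
  consider "v = {}" | "(\<Sum>i\<in>u. d i) = k" | i where "i \<in> v" "(\<Sum>i\<in>u. d i) < k"
    using prems(2) by fastforce
  then show ?case
  proof cases
    case 1
    then show ?thesis using elementary[OF prems(2,3)] by simp
  next
    case 2
    \<comment> \<open>Here the cell has volume \<open>2 ^ - k\<close>, hence contains exactly
      \<open>2 ^ t\<close> of the \<open>2 ^ (t + k)\<close> points.\<close>
    have "\<bar>box_disc u B y (\<lambda>i. real (c i) / 2 ^ d i) (\<lambda>i. if i \<in> v then z i else (real (c i) + 1) / 2 ^ d i)\<bar>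
      \<le> card B * (\<Prod>i\<in>u. (real (c i) + 1) / 2 ^ d i - real (c i) / 2 ^ d i)"
      by (rule box_disc_le[OF u elementary[OF prems(2,3)]]) (use prems(4) in \<open>auto simp: divide_right_mono\<close>)
    also have "(\<Prod>i\<in>u. (real (c i) + 1) / 2 ^ d i - real (c i) / 2 ^ d i) = 1 / 2 ^ (\<Sum>i\<in>u. d i)"
      by (simp add: diff_divide_distrib[symmetric] prod_dividef power_sum)
    finally show ?thesis
      using 2 by (simp add: B power_add)
  next
    case 3
    define d' where "d' = d(i := Suc (d i))"
    define c0 where "c0 = c(i := 2 * c i)"
    define c1 where "c1 = c(i := 2 * c i + 1)"
    have i: "i \<in> u" using 3 prems by auto
    have sum: "(\<Sum>i\<in>u. d' i) = Suc (\<Sum>i\<in>u. d i)"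
      unfolding d'_def using u i by (simp add: sum.remove[of u i])
    define R where "R = k - (\<Sum>i\<in>u. d' i)"
    have R: "k - (\<Sum>i\<in>u. d i) = Suc R" and dk: "(\<Sum>i\<in>u. d' i) \<le> k"
      using 3 sum by (auto simp: R_def)
    have c: "c0 j < 2 ^ d' j" "c1 j < 2 ^ d' j" if "j \<in> u" for j
      using prems(3)[OF that] by (auto simp: c0_def c1_def d'_def)
    have *: "R + 1 \<le> Suc R" by simp
    \<comment> \<open>The midpoint of the cell in direction \<open>i\<close>; \<open>c0\<close> and
      \<open>c1\<close> index the lower and the upper half.\<close>
    define h where "h = (2 * real (c i) + 1) / 2 ^ Suc (d i)"
    have zi: "real (c i) / 2 ^ d i \<le> z i" "z i \<le> (real (c i) + 1) / 2 ^ d i"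
      using prems(4) 3 by auto
    have h: "real (c i) / 2 ^ d i \<le> h"
      by (simp add: h_def field_simps)
    show ?thesis
    \<comment> \<open>If \<open>z i\<close> is at most the midpoint, the box lies in the lower half.
      Otherwise the lower half is complete in direction \<open>i\<close>, so that \<open>i\<close>
      leaves \<open>v\<close> there, while the upper half is still cut.\<close>
    proof (cases "z i \<le> h")
      case True
      have "\<bar>box_disc u B y (\<lambda>i. real (c0 i) / 2 ^ d' i)
         (\<lambda>i. if i \<in> v then z i else (real (c0 i) + 1) / 2 ^ d' i)\<bar> \<le> 2 ^ t * (real (k - (\<Sum>i\<in>u. d' i)) + 1) ^ card v"
      proof (intro less.hyps prems dk c)
        show "card v + (k - (\<Sum>i\<in>u. d' i)) < card v + (k - (\<Sum>i\<in>u. d i))"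
          by (simp add: R_def[symmetric] R)
        show "real (c0 j) / 2 ^ d' j \<le> z j \<and> z j \<le> (real (c0 j) + 1) / 2 ^ d' j" if "j \<in> v" for j
          using that prems(4)[OF that] True by (auto simp: c0_def d'_def h_def field_simps)
      qed
      also have "box_disc u B y (\<lambda>i. real (c0 i) / 2 ^ d' i)
         (\<lambda>i. if i \<in> v then z i else (real (c0 i) + 1) / 2 ^ d' i) =
        box_disc u B y (\<lambda>i. real (c i) / 2 ^ d i) (\<lambda>i. if i \<in> v then z i else (real (c i) + 1) / 2 ^ d i)"
        using 3 by (intro box_disc_cong) (auto simp: c0_def d'_def)
      also have "2 ^ t * (real (k - (\<Sum>i\<in>u. d' i)) + 1) ^ card v \<le> 2 ^ t * (real (k - (\<Sum>i\<in>u. d i)) + 1) ^ card v"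
        by (intro mult_left_mono power_mono) (auto simp: R R_def[symmetric])
      finally show ?thesis .
    next
      case False
      let ?l = "\<lambda>i. real (c i) / 2 ^ d i" and ?r = "\<lambda>i. if i \<in> v then z i else (real (c i) + 1) / 2 ^ d i"
      have "box_disc u B y ?l ?r = box_disc u B y ?l (?r(i := h)) + box_disc u B y (?l(i := h)) ?r"
        using 3 i u h False by (intro box_disc_split) auto
      moreover have "box_disc u B y ?l (?r(i := h)) = box_disc u B y (\<lambda>i. real (c0 i) / 2 ^ d' i)
         (\<lambda>j. if j \<in> v - {i} then z j else (real (c0 j) + 1) / 2 ^ d' j)"
        using 3 by (intro box_disc_cong) (auto simp: c0_def d'_def h_def)
      moreover have "box_disc u B y (?l(i := h)) ?r = box_disc u B y (\<lambda>i. real (c1 i) / 2 ^ d' i)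
         (\<lambda>i. if i \<in> v then z i else (real (c1 i) + 1) / 2 ^ d' i)"
        using 3 by (intro box_disc_cong) (auto simp: c1_def d'_def h_def)
      moreover have "\<bar>box_disc u B y (\<lambda>i. real (c0 i) / 2 ^ d' i)
         (\<lambda>j. if j \<in> v - {i} then z j else (real (c0 j) + 1) / 2 ^ d' j)\<bar>
        \<le> 2 ^ t * (real (k - (\<Sum>i\<in>u. d' i)) + 1) ^ card (v - {i})"
      proof (intro less.hyps dk)
        show "card (v - {i}) + (k - (\<Sum>i\<in>u. d' i)) < card v + (k - (\<Sum>i\<in>u. d i))"
          using v 3 by (simp add: R_def[symmetric] R card_Diff1_le le_imp_less_Suc add_mono)
        show "real (c0 j) / 2 ^ d' j \<le> z j \<and> z j \<le> (real (c0 j) + 1) / 2 ^ d' j" if "j \<in> v - {i}" for j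
          using that prems(4)[of j] by (auto simp: c0_def d'_def)
      qed (use prems c in auto)
      moreover have "\<bar>box_disc u B y (\<lambda>i. real (c1 i) / 2 ^ d' i)
         (\<lambda>i. if i \<in> v then z i else (real (c1 i) + 1) / 2 ^ d' i)\<bar>
        \<le> 2 ^ t * (real (k - (\<Sum>i\<in>u. d' i)) + 1) ^ card v"
      proof (intro less.hyps dk)
        show "real (c1 j) / 2 ^ d' j \<le> z j \<and> z j \<le> (real (c1 j) + 1) / 2 ^ d' j" if "j \<in> v" for j
          using that prems(4)[OF that] False by (auto simp: c1_def d'_def h_def field_simps)
      qed (use prems c R in \<open>auto simp: R_def[symmetric]\<close>)
      \<comment> \<open>With \<open>card v = j + 1\<close>:
        \<open>(R + 1) ^ j + (R + 1) ^ (j + 1) = (R + 1) ^ j * (R + 2)\<close>.\<close>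
      moreover have "2 ^ t * (real R + 1) ^ card (v - {i}) + 2 ^ t * (real R + 1) ^ card v
        \<le> 2 ^ t * (real (Suc R) + 1) ^ card v"
      proof -
        obtain j where j: "card v = Suc j"
          using 3 v by (metis card_gt_0_iff empty_iff gr0_implies_Suc)
        then have "card (v - {i}) = j" using 3 by simp
        then have "2 ^ t * (real R + 1) ^ card (v - {i}) + 2 ^ t * (real R + 1) ^ card v
          = 2 ^ t * ((real R + 1) ^ j * (real (Suc R) + 1))"
          using j by (simp add: algebra_simps)
        also have "\<dots> \<le> 2 ^ t * ((real (Suc R) + 1) ^ j * (real (Suc R) + 1))"
          by (intro mult_left_mono mult_right_mono power_mono) auto
        finally show ?thesis
          using j by (simp add: algebra_simps)
      qed
      ultimately show ?thesis
        unfolding R_def[symmetric] R by linarith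
    qed
  qed
qed

text \<open>The bisection starts from the unit cube, the cell with all \<open>d i = 0\<close>, with
  every coordinate cut.\<close>

lemma net_box_disc:
  fixes z :: "nat \<Rightarrow> real" and y :: "nat \<Rightarrow> nat \<Rightarrow> real"
  assumes "finite u" "card B = 2 ^ (t + k)"
    and "\<And>d c. (\<Sum>i\<in>u. d i) \<le> k \<Longrightarrow> (\<And>i. i \<in> u \<Longrightarrow> c i < 2 ^ d i) \<Longrightarrow>
      box_disc u B y (\<lambda>i. real (c i) / 2 ^ d i) (\<lambda>i. (real (c i) + 1) / 2 ^ d i) = 0"
    and z: "\<And>i. i \<in> u \<Longrightarrow> 0 \<le> z i \<and> z i \<le> 1"
  shows "\<bar>box_disc u B y (\<lambda>_. 0) z\<bar> \<le> 2 ^ t * (real k + 1) ^ card u"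
proof -
  have "\<bar>box_disc u B y (\<lambda>i. real ((\<lambda>_. 0) i) / 2 ^ (\<lambda>_. 0) i)
      (\<lambda>i. if i \<in> u then z i else (real ((\<lambda>_. 0) i) + 1) / 2 ^ (\<lambda>_. 0) i)\<bar>
    \<le> 2 ^ t * (real (k - (\<Sum>i\<in>u. (\<lambda>_. 0) i)) + 1) ^ card u"
    by (rule net_box_disc_cut[OF assms(1-3)]) (use z in auto)
  moreover have "box_disc u B y (\<lambda>i. real ((\<lambda>_. 0) i) / 2 ^ (\<lambda>_. 0) i)
      (\<lambda>i. if i \<in> u then z i else (real ((\<lambda>_. 0) i) + 1) / 2 ^ (\<lambda>_. 0) i) = box_disc u B y (\<lambda>_. 0) z"
    by (rule box_disc_cong) auto
  ultimately show ?thesis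
    by simp
qed

text \<open>This serves for blocks too short to form a net.\<close>

lemma box_disc_trivial:
  assumes "finite B" "finite u" "\<And>i. i \<in> u \<Longrightarrow> 0 \<le> z i \<and> z i \<le> 1"
  shows "\<bar>box_disc u B y (\<lambda>_. 0) z\<bar> \<le> card B"
proof -
  have "(\<Sum>n\<in>B. \<Prod>i\<in>u. of_bool (0 \<le> y n i \<and> y n i < z i) :: real) \<le> (\<Sum>n\<in>B. 1)"
    by (intro sum_mono prod_le_1) auto
  moreover have "0 \<le> (\<Sum>n\<in>B. \<Prod>i\<in>u. of_bool (0 \<le> y n i \<and> y n i < z i) :: real)"
    by (intro sum_nonneg prod_nonneg) auto
  moreover have "real (card B) * (\<Prod>i\<in>u. z i - 0) \<le> card B"
    using assms by (intro mult_left_le prod_le_1) auto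
  moreover have "0 \<le> real (card B) * (\<Prod>i\<in>u. z i - 0)"
    using assms by (intro mult_nonneg_nonneg prod_nonneg) auto
  ultimately show ?thesis
    unfolding box_disc_def abs_le_iff by simp
qed

section \<open>Linear independence and elementary intervals\<close>

lemma rows_lin_indep_mono:
  assumes "finite u" "rows_lin_indep u m d' A" and le: "\<And>i. i \<in> u \<Longrightarrow> d i \<le> d' i"
  shows "rows_lin_indep u m d A"
  unfolding rows_lin_indep_def
proof (intro allI impI)
  fix \<kappa> :: "nat \<Rightarrow> nat \<Rightarrow> bit"
  assume *: "\<forall>l<m. (\<Sum>i\<in>u. \<Sum>k<d i. \<kappa> i k * A i k l) = 0"
  define \<kappa>' :: "nat \<Rightarrow> nat \<Rightarrow> bit" where "\<kappa>' i k = (if k < d i then \<kappa> i k else 0)" for i k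
  have "(\<Sum>k<d' i. \<kappa>' i k * A i k l) = (\<Sum>k<d i. \<kappa> i k * A i k l)" if "i \<in> u" for i l
    using le[OF that] by (intro sum.mono_neutral_cong_right) (auto simp: \<kappa>'_def)
  with * have "\<forall>l<m. (\<Sum>i\<in>u. \<Sum>k<d' i. \<kappa>' i k * A i k l) = 0"
    by simp
  then have "\<forall>i\<in>u. \<forall>k<d' i. \<kappa>' i k = 0"
    using assms(2) unfolding rows_lin_indep_def by blast
  then show "\<forall>i\<in>u. \<forall>k<d i. \<kappa> i k = 0"
    using le unfolding \<kappa>'_def by (metis less_le_trans)
qed

lemma digital_net_rows_lin_indep:
  assumes "finite u" "u \<noteq> {}" "digital_net u t m C" "(\<Sum>i\<in>u. d i) \<le> m - t"
  shows "rows_lin_indep u m d C"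
proof -
  obtain j where j: "j \<in> u" using assms by auto
  \<comment> \<open>The net property speaks of sums equal to \<open>m - t\<close>; one coordinate
    takes up the missing rows.\<close>
  define d' where "d' = d(j := d j + (m - t - (\<Sum>i\<in>u. d i)))"
  have "(\<Sum>i\<in>u. d' i) = m - t"
    using assms(1,4) j by (simp add: d'_def sum.remove[of u j])
  then have "rows_lin_indep u m d' C"
    using assms(3) by (simp add: digital_net_def)
  then show ?thesis
    by (rule rows_lin_indep_mono[OF assms(1)]) (simp add: d'_def)
qed

text \<open>Lying in the cell prescribes the first \<open>d i\<close> digits in each coordinate, and
  by independence every pattern occurs equally often in the block.\<close>

lemma digital_net_elementary:
  assumes u: "finite u" "u \<noteq> {}" and net: "digital_net u t m C" and fin: "\<And>i. i \<in> u \<Longrightarrow> column_finite (C i)"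
    and d: "(\<Sum>i\<in>u. d i) \<le> m - t" and c: "\<And>i. i \<in> u \<Longrightarrow> c i < 2 ^ d i"
  shows "box_disc u {K * 2 ^ m..<(K + 1) * 2 ^ m} (\<lambda>n i. digital_coord (C i) n)
    (\<lambda>i. real (c i) / 2 ^ d i) (\<lambda>i. (real (c i) + 1) / 2 ^ d i) = 0"
proof -
  define e :: "nat \<Rightarrow> nat \<Rightarrow> bit" where "e i k = of_bool (odd (c i div 2 ^ (d i - Suc k)))" for i k
  have cell: "real (c i) / 2 ^ d i \<le> digital_coord (C i) n \<and> digital_coord (C i) n < (real (c i) + 1) / 2 ^ d i
    \<longleftrightarrow> (\<forall>k<d i. mat_digit (C i) n k = e i k)" if i: "i \<in> u" for i n
  proof -
    obtain D where "\<And>k. k \<ge> D \<Longrightarrow> mat_digit (C i) n k = 0"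
      using mat_digit_finite[OF fin[OF i]] by blast
    then show ?thesis
      unfolding e_def digital_coord_def by (rule digit_cell_iff) (use c i in auto)
  qed
  have "(\<Sum>n\<in>{K * 2 ^ m..<(K + 1) * 2 ^ m}. \<Prod>i\<in>u. of_bool (real (c i) / 2 ^ d i \<le> digital_coord (C i) n
      \<and> digital_coord (C i) n < (real (c i) + 1) / 2 ^ d i))
    = (\<Sum>n\<in>{K * 2 ^ m..<(K + 1) * 2 ^ m}. of_bool (\<forall>i\<in>u. \<forall>k<d i. mat_digit (C i) n k = e i k) :: real)"
    unfolding of_bool_ball_eq_prod[OF u(1)] using cell by simp
  also have "\<dots> = (\<Sum>v<2 ^ m. of_bool (\<forall>i\<in>u. \<forall>k<d i. mat_digit (C i) (K * 2 ^ m + v) k = e i k))"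
    by (rule sum.reindex_bij_witness[of _ "\<lambda>v. K * 2 ^ m + v" "\<lambda>n. n - K * 2 ^ m"]) auto
  also have "\<dots> = 2 ^ m / 2 ^ (\<Sum>i\<in>u. d i)"
    by (rule sum_digit_pattern[OF u(1) digital_net_rows_lin_indep[OF u net d]])
  also have "\<dots> = real (card {K * 2 ^ m..<(K + 1) * 2 ^ m}) *
      (\<Prod>i\<in>u. (real (c i) + 1) / 2 ^ d i - real (c i) / 2 ^ d i)"
    by (simp add: diff_divide_distrib[symmetric] prod_dividef power_sum)
  finally show ?thesis
    by (simp add: box_disc_def)
qed

lemma digital_block_disc:
  assumes u: "finite u" "u \<noteq> {}" and seq: "digital_sequence u t C x"
    and z: "\<And>i. i \<in> u \<Longrightarrow> 0 \<le> z i \<and> z i \<le> 1"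
  shows "\<bar>box_disc u {K * 2 ^ m..<(K + 1) * 2 ^ m} x (\<lambda>_. 0) z\<bar> \<le> 2 ^ t * (real m + 1) ^ card u"
proof (cases "t \<le> m \<and> 1 \<le> m")
  case True
  have net: "digital_net u t m C" and fin: "\<And>i. i \<in> u \<Longrightarrow> column_finite (C i)"
    and x: "x = digital_points u C"
    using seq True by (auto simp: digital_sequence_def)
  have "box_disc u {K * 2 ^ m..<(K + 1) * 2 ^ m} x (\<lambda>_. 0) z =
    box_disc u {K * 2 ^ m..<(K + 1) * 2 ^ m} (\<lambda>n i. digital_coord (C i) n) (\<lambda>_. 0) z"
    by (rule box_disc_cong) (auto simp: x digital_points_def)
  also have "\<bar>\<dots>\<bar> \<le> 2 ^ t * (real (m - t) + 1) ^ card u"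
    using True by (intro net_box_disc u z digital_net_elementary[OF u net fin]) auto
  also have "\<dots> \<le> 2 ^ t * (real m + 1) ^ card u"
    by (intro mult_left_mono power_mono) auto
  finally show ?thesis .
next
  case False
  \<comment> \<open>Such a block has at most \<open>2 ^ t\<close> points, since \<open>m < t\<close>
    or \<open>m = 0\<close>.\<close>
  have "\<bar>box_disc u {K * 2 ^ m..<(K + 1) * 2 ^ m} x (\<lambda>_. 0) z\<bar> \<le> card {K * 2 ^ m..<(K + 1) * 2 ^ m}"
    by (rule box_disc_trivial) (use u z in auto)
  also have "\<dots> \<le> (2 ^ t :: real)"
    using False by (auto simp: not_le)
  also have "\<dots> \<le> 2 ^ t * (real m + 1) ^ card u"
    by simp
  finally show ?thesis .
qed

lemma box_disc_union:
  assumes "finite A" "finite B" "A \<inter> B = {}"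
  shows "box_disc u (A \<union> B) y l r = box_disc u A y l r + box_disc u B y l r"
  using assms by (simp add: box_disc_def sum.union_disjoint card_Un_disjoint algebra_simps)

text \<open>The induction removes the binary digits of \<open>N\<close> from the top. A leading 1
  splits off a block of \<open>2 ^ M\<close> points, and the rest again starts at a multiple of
  \<open>2 ^ M\<close>, as the position \<open>K\<close> records. Each of the blocks contributes at
  most \<open>E\<close>; \<open>L\<close> keeps their lengths within the range of
  \<open>bound\<close>.\<close>

lemma digital_segment_disc:
  assumes u: "finite u" "u \<noteq> {}" and seq: "digital_sequence u t C x"
    and z: "\<And>i. i \<in> u \<Longrightarrow> 0 \<le> z i \<and> z i \<le> 1"
    and bound: "\<And>m. 2 ^ m \<le> L \<Longrightarrow> 2 ^ t * (real m + 1) ^ card u \<le> E"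
    and E: "0 \<le> E"
  shows "N < 2 ^ M \<Longrightarrow> N \<le> L \<Longrightarrow> \<bar>box_disc u {K * 2 ^ M..<K * 2 ^ M + N} x (\<lambda>_. 0) z\<bar> \<le> M * E"
proof (induction M arbitrary: K N)
  case 0
  then show ?case by (simp add: box_disc_def)
next
  case (Suc M)
  show ?case
  proof (cases "N < 2 ^ M")
    case True
    have "\<bar>box_disc u {2 * K * 2 ^ M..<2 * K * 2 ^ M + N} x (\<lambda>_. 0) z\<bar> \<le> M * E"
      using True Suc by blast
    then show ?thesis
      using E by (simp add: algebra_simps)
  next
    case False
    define N' where "N' = N - 2 ^ M"
    have N: "N = 2 ^ M + N'" "N' < 2 ^ M" "N' \<le> L" "2 ^ M \<le> L"
      using Suc.prems False by (auto simp: N'_def)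
    have "{K * 2 ^ Suc M..<K * 2 ^ Suc M + N} =
      {2 * K * 2 ^ M..<(2 * K + 1) * 2 ^ M} \<union> {(2 * K + 1) * 2 ^ M..<(2 * K + 1) * 2 ^ M + N'}"
      using N(1) by (auto simp: algebra_simps)
    then have "box_disc u {K * 2 ^ Suc M..<K * 2 ^ Suc M + N} x (\<lambda>_. 0) z =
      box_disc u {2 * K * 2 ^ M..<(2 * K + 1) * 2 ^ M} x (\<lambda>_. 0) z +
      box_disc u {(2 * K + 1) * 2 ^ M..<(2 * K + 1) * 2 ^ M + N'} x (\<lambda>_. 0) z"
      by (simp only: box_disc_union finite_atLeastLessThan) (subst box_disc_union; simp)
    moreover have "\<bar>box_disc u {2 * K * 2 ^ M..<(2 * K + 1) * 2 ^ M} x (\<lambda>_. 0) z\<bar> \<le> E"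
      by (rule order_trans[OF digital_block_disc[OF u seq z] bound[OF N(4)]])
    moreover have "\<bar>box_disc u {(2 * K + 1) * 2 ^ M..<(2 * K + 1) * 2 ^ M + N'} x (\<lambda>_. 0) z\<bar> \<le> M * E"
      using N by (intro Suc.IH)
    ultimately show ?thesis
      by (simp add: algebra_simps)
  qed
qed

lemma digital_sequence_disc:
  assumes u: "finite u" "u \<noteq> {}" and seq: "digital_sequence u t C x"
    and z: "\<And>i. i \<in> u \<Longrightarrow> 0 \<le> z i \<and> z i \<le> 1" and N: "2 \<le> N"
  shows "\<bar>box_disc u {..<N} x (\<lambda>_. 0) z\<bar> \<le> 3 * ln (2 * real N) / ln 2 * (2 ^ t * (3 * ln (real N)) ^ card u)"
proof -
  define E where "E = 2 ^ t * (3 * ln (real N)) ^ card u"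
  have ln2: "2 / 3 \<le> ln (2::real)"
    using ln2_ge_two_thirds by simp
  have lnN: "ln 2 \<le> ln (real N)"
    using N by simp
  have E0: "0 \<le> E"
    using lnN ln2 by (simp add: E_def)
  have bound: "2 ^ t * (real m + 1) ^ card u \<le> E" if "2 ^ m \<le> N" for m
  proof -
    have "real (2 ^ m) \<le> real N"
      using that by (rule of_nat_mono)
    then have "ln (2 ^ m) \<le> ln (real N)"
      using N by (subst ln_le_cancel_iff) auto
    then have "real m * ln 2 \<le> ln (real N)"
      by (simp add: ln_realpow)
    moreover have "real m * (2 / 3) \<le> real m * ln 2"
      using ln2 by (intro mult_left_mono) auto
    ultimately have le: "real m * (2 / 3) \<le> ln (real N)"
      by linarith
    \<comment> \<open>For \<open>m >= 1\<close>, \<open>m + 1 <= 2 * m = 3 * (m * (2 / 3))\<close>;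
      for \<open>m = 0\<close>, \<open>1 <= 3 * ln 2 <= 3 * ln N\<close>.\<close>
    have "real m + 1 \<le> 3 * ln (real N)"
    proof (cases "m = 0")
      case False
      then have "1 \<le> real m" by linarith
      then show ?thesis
        using le by linarith
    qed (use ln2 lnN in simp)
    then show ?thesis
      unfolding E_def by (intro mult_left_mono power_mono) auto
  qed
  obtain M where M: "2 ^ M \<le> N" "N < 2 ^ Suc M"
    using ex_power_ivl1[of 2 N] N by auto
  have "\<bar>box_disc u {0 * 2 ^ Suc M..<0 * 2 ^ Suc M + N} x (\<lambda>_. 0) z\<bar> \<le> Suc M * E"
    by (rule digital_segment_disc[OF u seq z bound E0 M(2)]) auto
  also have "real (Suc M) * E \<le> 3 * ln (2 * real N) / ln 2 * E"
  proof (rule mult_right_mono[OF _ E0])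
    \<comment> \<open>\<open>Suc M\<close> is the number of binary digits of \<open>N\<close>, and
      \<open>2 ^ Suc M <= 2 * N\<close>.\<close>
    have "real (2 ^ M) \<le> real N"
      using M(1) by (rule of_nat_mono)
    then have "ln (2 ^ Suc M) \<le> ln (2 * real N)"
      using N by (subst ln_le_cancel_iff) auto
    then have "real (Suc M) * ln 2 \<le> ln (2 * real N)"
      by (simp only: ln_realpow)
    then have "real (Suc M) \<le> ln (2 * real N) / ln 2"
      using ln2 by (simp add: pos_le_divide_eq)
    then show "real (Suc M) \<le> 3 * ln (2 * real N) / ln 2"
      by simp
  qed
  finally show ?thesis
    by (simp add: E_def atLeast0LessThan)
qed

subsection \<open>Mixed differences\<close>

definition coord_diff ::
    "(nat \<Rightarrow> real) \<Rightarrow> (nat \<Rightarrow> real) \<Rightarrow> nat \<Rightarrow> ((nat \<Rightarrow> real) \<Rightarrow> real) \<Rightarrow> (nat \<Rightarrow> real) \<Rightarrow> real" where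
  "coord_diff l r i F x = F (x(i := r i)) - F (x(i := l i))"

text \<open>An alternating sum of \<open>F\<close> over the corners of a box in the coordinates
  \<open>u\<close>. The \<open>foldr\<close> runs over the same list as in
  \<open>mixed_partial\<close>, so that differences can be exchanged for derivatives one coordinate
  at a time.\<close>

definition mixed_diff ::
    "(nat \<Rightarrow> real) \<Rightarrow> (nat \<Rightarrow> real) \<Rightarrow> nat set \<Rightarrow> ((nat \<Rightarrow> real) \<Rightarrow> real) \<Rightarrow> (nat \<Rightarrow> real) \<Rightarrow> real" where
  "mixed_diff l r u F = foldr (coord_diff l r) (sorted_list_of_set u) F"

lemma box_on_upd:
  fixes x a b :: "nat \<Rightarrow> real" and \<xi> :: real
  assumes "x \<in> box_on I a b" "i \<in> I" "\<xi> \<in> {a i..b i}"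
  shows "x(i := \<xi>) \<in> box_on I a b"
  using assms by (auto simp: box_on_def PiE_iff extensional_def)

text \<open>Differences in distinct coordinates commute; the innermost one is moved outside, where
  the mean value theorem can act on it.\<close>

lemma foldr_coord_diff_commute:
  fixes F :: "(nat \<Rightarrow> real) \<Rightarrow> real" and l r x :: "nat \<Rightarrow> real"
  assumes "i \<notin> set js"
  shows "foldr (coord_diff l r) js (coord_diff l r i F) x =
    foldr (coord_diff l r) js F (x(i := r i)) - foldr (coord_diff l r) js F (x(i := l i))"
  using assms
proof (induction js arbitrary: x)
  case (Cons j js)
  \<comment> \<open>The term \<open>?case\<close> is eta-expanded, so that \<open>fun_upd_apply\<close> would unfold the updates in it.\<close>
  then have "i \<noteq> j" by auto
  with Cons show ?case
    by (simp add: coord_diff_def[of l r j] fun_upd_twist del: fun_upd_apply)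
qed (simp add: coord_diff_def)

text \<open>An iterated difference is a finite signed sum of values of the function, so it is
  differentiated termwise in another coordinate, without any interchange of limits.\<close>

lemma foldr_coord_diff_has_vector_derivative:
  fixes F F' :: "(nat \<Rightarrow> real) \<Rightarrow> real" and a b l r x :: "nat \<Rightarrow> real" and i :: nat and \<tau> :: real
  assumes deriv: "\<And>y. y \<in> box_on I a b \<Longrightarrow>
      ((\<lambda>\<xi>. F (y(i := \<xi>))) has_vector_derivative F' (y(i := \<tau>))) (at \<tau> within {a i..b i})"
    and "i \<notin> set js" "set js \<subseteq> I" "x \<in> box_on I a b"
    and "\<And>j. j \<in> set js \<Longrightarrow> l j \<in> {a j..b j} \<and> r j \<in> {a j..b j}"
  shows "((\<lambda>\<xi>. foldr (coord_diff l r) js F (x(i := \<xi>))) has_vector_derivative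
    foldr (coord_diff l r) js F' (x(i := \<tau>))) (at \<tau> within {a i..b i})"
  using assms(2-)
proof (induction js arbitrary: x)
  case Nil
  then show ?case using deriv by (simp del: fun_upd_apply)
next
  case (Cons j js)
  have ij: "i \<noteq> j" using Cons.prems by auto
  have *: "foldr (coord_diff l r) (j # js) G (x(i := \<xi>)) =
    foldr (coord_diff l r) js G ((x(j := r j))(i := \<xi>)) - foldr (coord_diff l r) js G ((x(j := l j))(i := \<xi>))"
    for G \<xi>
    using ij by (simp add: coord_diff_def[of l r j] fun_upd_twist)
  show ?case
    unfolding * using Cons.prems
    by (intro has_vector_derivative_diff Cons.IH box_on_upd) auto
qed

lemma partial_deriv_has_vector_derivative:
  fixes F :: "(nat \<Rightarrow> real) \<Rightarrow> real" and a b y :: "nat \<Rightarrow> real" and i :: nat and \<tau> :: real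
  assumes "\<And>x. x \<in> box_on I a b \<Longrightarrow> (\<lambda>\<xi>. F (x(i := \<xi>))) differentiable (at (x i) within {a i..b i})"
    and "y \<in> box_on I a b" "i \<in> I" "\<tau> \<in> {a i..b i}"
  shows "((\<lambda>\<xi>. F (y(i := \<xi>))) has_vector_derivative partial_deriv a b i F (y(i := \<tau>))) (at \<tau> within {a i..b i})"
  using assms(1)[OF box_on_upd[OF assms(2-4)]]
  by (simp add: partial_deriv_def vector_derivative_works)

lemma mvt_within:
  fixes f :: "real \<Rightarrow> real"
  assumes "\<And>\<tau>. \<tau> \<in> {a..b} \<Longrightarrow> (f has_vector_derivative f' \<tau>) (at \<tau> within {a..b})"
    and "a \<le> l" "l \<le> r" "r \<le> b"
  obtains \<xi> where "\<xi> \<in> {l..r}" "f r - f l = (r - l) * f' \<xi>"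
proof (cases "l = r")
  case True
  then show ?thesis using that[of l] by auto
next
  case False
  have "(f has_derivative (\<lambda>h. h * f' \<tau>)) (at \<tau> within {l..r})" if "l \<le> \<tau>" "\<tau> \<le> r" for \<tau>
    using has_derivative_subset[OF assms(1)[of \<tau>, unfolded has_vector_derivative_def], of "{l..r}"] assms that
    by auto
  then obtain \<xi> where "\<xi> \<in> {l<..<r}" "f r - f l = (r - l) * f' \<xi>"
    using mvt_simple[of l r f "\<lambda>\<tau> h. h * f' \<tau>"] False assms by auto
  then show ?thesis using that[of \<xi>] by auto
qed

text \<open>The last coordinate \<open>i\<close> of the list comes first: the mean value theorem
  turns its difference into a derivative under the remaining differences, and the induction goes on
  with \<open>partial_deriv a b i F\<close>. Only derivatives along suffixes of \<open>ks\<close>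
  occur, and no continuity of them is used.\<close>

lemma foldr_coord_diff_mvt:
  fixes F :: "(nat \<Rightarrow> real) \<Rightarrow> real" and a b l r x :: "nat \<Rightarrow> real"
  assumes "\<And>ls k js x. ks = ls @ k # js \<Longrightarrow> x \<in> box_on I a b \<Longrightarrow>
      (\<lambda>\<xi>. foldr (partial_deriv a b) js F (x(k := \<xi>))) differentiable (at (x k) within {a k..b k})"
    and "distinct ks" "set ks \<subseteq> I" "x \<in> box_on I a b"
    and "\<And>i. i \<in> set ks \<Longrightarrow> a i \<le> l i \<and> l i \<le> r i \<and> r i \<le> b i"
  shows "\<exists>y\<in>box_on I a b. foldr (coord_diff l r) ks F x =
    (\<Prod>i\<in>set ks. r i - l i) * foldr (partial_deriv a b) ks F y"
  using assms
proof (induction ks arbitrary: F x rule: rev_induct)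
  case (snoc i ks)
  have i: "i \<notin> set ks" "i \<in> I" "a i \<le> l i" "l i \<le> r i" "r i \<le> b i"
    using snoc.prems by auto
  have "((\<lambda>\<xi>. foldr (coord_diff l r) ks F (x(i := \<xi>))) has_vector_derivative
      foldr (coord_diff l r) ks (partial_deriv a b i F) (x(i := \<tau>))) (at \<tau> within {a i..b i})"
    if "\<tau> \<in> {a i..b i}" for \<tau>
  proof (rule foldr_coord_diff_has_vector_derivative)
    show "((\<lambda>\<xi>. F (y(i := \<xi>))) has_vector_derivative partial_deriv a b i F (y(i := \<tau>))) (at \<tau> within {a i..b i})"
      if "y \<in> box_on I a b" for y
      using that \<open>\<tau> \<in> _\<close> i snoc.prems(1)[of ks i "[]"]
      by (intro partial_deriv_has_vector_derivative) (auto simp del: fun_upd_apply)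
  qed (use snoc.prems(2-4) snoc.prems(5) i in force)+
  then obtain \<xi> where \<xi>: "\<xi> \<in> {l i..r i}"
    "foldr (coord_diff l r) ks F (x(i := r i)) - foldr (coord_diff l r) ks F (x(i := l i)) =
      (r i - l i) * foldr (coord_diff l r) ks (partial_deriv a b i F) (x(i := \<xi>))"
    by (rule mvt_within) (use i in auto)
  have "\<exists>y\<in>box_on I a b. foldr (coord_diff l r) ks (partial_deriv a b i F) (x(i := \<xi>)) =
    (\<Prod>i\<in>set ks. r i - l i) * foldr (partial_deriv a b) ks (partial_deriv a b i F) y"
  proof (rule snoc.IH)
    fix ls k js y assume *: "ks = ls @ k # js" "y \<in> box_on I a b"
    show "(\<lambda>\<xi>. foldr (partial_deriv a b) js (partial_deriv a b i F) (y(k := \<xi>))) differentiable (at (y k) within {a k..b k})"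
      using snoc.prems(1)[of ls k "js @ [i]" y] * by (simp del: fun_upd_apply)
  next
    show "x(i := \<xi>) \<in> box_on I a b"
      using \<xi>(1) i snoc.prems(4) by (intro box_on_upd) auto
  qed (use snoc.prems in auto)
  then obtain y where "y \<in> box_on I a b" "foldr (coord_diff l r) ks (partial_deriv a b i F) (x(i := \<xi>)) =
    (\<Prod>i\<in>set ks. r i - l i) * foldr (partial_deriv a b) ks (partial_deriv a b i F) y"
    by blast
  with \<xi>(2) i(1) show ?case
    by (intro bexI[of _ y]) (simp_all add: foldr_coord_diff_commute)
qed auto

lemma mixed_diff_mvt:
  fixes F :: "(nat \<Rightarrow> real) \<Rightarrow> real" and a b l r x :: "nat \<Rightarrow> real"
  assumes "has_mixed_partials I a b F" "finite u" "u \<subseteq> I" "x \<in> box_on I a b"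
    and "\<And>i. i \<in> u \<Longrightarrow> a i \<le> l i \<and> l i \<le> r i \<and> r i \<le> b i"
  shows "\<exists>y\<in>box_on I a b. mixed_diff l r u F x = (\<Prod>i\<in>u. r i - l i) * mixed_partial a b u F y"
proof -
  let ?ks = "sorted_list_of_set u"
  have "\<exists>y\<in>box_on I a b. foldr (coord_diff l r) ?ks F x =
    (\<Prod>i\<in>set ?ks. r i - l i) * foldr (partial_deriv a b) ?ks F y"
  proof (rule foldr_coord_diff_mvt)
    fix ls k js y
    assume ks: "?ks = ls @ k # js" and y: "y \<in> box_on I a b"
    have "sorted ?ks" "distinct ?ks" "set ?ks = u"
      using assms(2) by auto
    \<comment> \<open>A proper suffix of the sorted list enumerates a set lying above
      \<open>k\<close>, the situation of \<open>has_mixed_partials\<close>.\<close>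
    then have js: "sorted js" "distinct js" "\<forall>j\<in>set js. k < j" "set js \<subseteq> I" "k \<in> I"
      using assms(3) unfolding ks by (auto simp: sorted_append order_less_le)
    then have "sorted_list_of_set (set js) = js"
      by (simp add: sorted_list_of_set.idem_if_sorted_distinct)
    then have "mixed_partial a b (set js) F = foldr (partial_deriv a b) js F"
      by (simp add: mixed_partial_def)
    then show "(\<lambda>\<xi>. foldr (partial_deriv a b) js F (y(k := \<xi>))) differentiable (at (y k) within {a k..b k})"
      using assms(1) js y unfolding has_mixed_partials_def by metis
  qed (use assms in auto)
  then show ?thesis
    using assms(2) by (simp add: mixed_diff_def mixed_partial_def)
qed

lemma mixed_diff_cong:
  assumes "finite u" "\<And>i. i \<in> u \<Longrightarrow> l i = l' i" "\<And>i. i \<in> u \<Longrightarrow> r i = r' i"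
  shows "mixed_diff l r u F = mixed_diff l' r' u F"
  unfolding mixed_diff_def using assms by (intro foldr_cong) (auto simp: coord_diff_def)

text \<open>The least coordinate heads the sorted list, so its difference is the outermost
  one.\<close>

lemma mixed_diff_insert_min:
  fixes F :: "(nat \<Rightarrow> real) \<Rightarrow> real" and l r x :: "nat \<Rightarrow> real"
  assumes "finite u" "\<And>j. j \<in> u \<Longrightarrow> i < j"
  shows "mixed_diff l r (insert i u) F x = mixed_diff l r u F (x(i := r i)) - mixed_diff l r u F (x(i := l i))"
proof -
  have "sorted_list_of_set (insert i u) = i # sorted_list_of_set u"
    using assms by (subst sorted_list_of_set_insert) (force, force, intro insort_is_Cons, auto intro: less_imp_le)
  then show ?thesis
    by (simp add: mixed_diff_def coord_diff_def)
qed

lemma telescope_indicator: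
  fixes f :: "nat \<Rightarrow> real"
  assumes "g \<le> n"
  shows "f g = f n - (\<Sum>h<n. of_bool (g \<le> h) * (f (Suc h) - f h))"
proof -
  have "(\<Sum>h<n. of_bool (g \<le> h) * (f (Suc h) - f h)) = (\<Sum>h\<in>{g..<n}. f (Suc h) - f h)"
    by (intro sum.mono_neutral_cong_right) auto
  also have "\<dots> = f n - f g"
    by (rule sum_Suc_diff'[OF assms])
  finally show ?thesis by simp
qed

lemma sum_PiE_insert:
  assumes "i \<notin> u"
  shows "(\<Sum>h\<in>PiE (insert i u) (\<lambda>_. S). f h) = (\<Sum>k\<in>S. \<Sum>h\<in>PiE u (\<lambda>_. S). f (h(i := k)))"
proof -
  have "(\<Sum>h\<in>PiE (insert i u) (\<lambda>_. S). f h) = (\<Sum>(k, h)\<in>S \<times> PiE u (\<lambda>_. S). f (h(i := k)))"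
    unfolding PiE_insert_eq using inj_combinator[OF assms, of "\<lambda>_. S"]
    by (simp add: sum.reindex case_prod_unfold)
  then show ?thesis
    by (simp add: sum.cartesian_product)
qed

lemma sum_Pow_insert:
  assumes "finite A" "i \<notin> A"
  shows "(\<Sum>u\<in>Pow (insert i A). f u) = (\<Sum>u\<in>Pow A. f u + f (insert i u) :: real)"
proof -
  have "inj_on (insert i) (Pow A)"
    using assms(2) by (auto simp: inj_on_def insert_ident)
  then show ?thesis
    unfolding Pow_insert using assms by (subst sum.union_disjoint) (auto simp: sum.reindex sum.distrib)
qed

text \<open>
  Summation by parts in each coordinate: each factor \<open>f (g i)\<close> ls expanded around the upper end
  point of the grid.
\<close>

lemma grid_expansion:
  fixes F :: "(nat \<Rightarrow> real) \<Rightarrow> real" and z :: "nat \<Rightarrow> nat \<Rightarrow> real" and x :: "nat \<Rightarrow> real"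
  assumes "finite A" "\<And>i. i \<in> A \<Longrightarrow> g i \<le> n"
  shows "F (\<lambda>i. if i \<in> A then z i (g i) else x i) =
    (\<Sum>u\<in>Pow A. (- 1) ^ card u * (\<Sum>h\<in>PiE u (\<lambda>_. {..<n}). (\<Prod>i\<in>u. of_bool (g i \<le> h i)) *
      mixed_diff (\<lambda>i. z i (h i)) (\<lambda>i. z i (Suc (h i))) u F (\<lambda>i. if i \<in> A then z i n else x i)))"
  using assms
proof (induction A arbitrary: x rule: finite_linorder_min_induct)
  case empty
  then show ?case by (simp add: mixed_diff_def)
next
  case (insert i A)
  let ?D = "\<lambda>h. mixed_diff (\<lambda>i. z i (h i)) (\<lambda>i. z i (Suc (h i)))"
  let ?X = "\<lambda>j. if j \<in> insert i A then z j n else x j"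
  have i: "i \<notin> A" using insert by auto
  have "F (\<lambda>j. if j \<in> insert i A then z j (g j) else x j) =
    F (\<lambda>j. if j \<in> A then z j (g j) else (x(i := z i (g i))) j)"
    using i by (intro arg_cong[of _ _ F]) auto
  also have "\<dots> = (\<Sum>u\<in>Pow A. (- 1) ^ card u * (\<Sum>h\<in>PiE u (\<lambda>_. {..<n}). (\<Prod>i\<in>u. of_bool (g i \<le> h i)) *
      ?D h u F (\<lambda>j. if j \<in> A then z j n else (x(i := z i (g i))) j)))"
    using insert by (intro insert.IH) auto
  also have "(\<lambda>j. if j \<in> A then z j n else (x(i := z i (g i))) j) = ?X(i := z i (g i))"
    using i by auto
  also have "(\<Sum>u\<in>Pow A. (- 1) ^ card u * (\<Sum>h\<in>PiE u (\<lambda>_. {..<n}). (\<Prod>i\<in>u. of_bool (g i \<le> h i)) *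
      ?D h u F (?X(i := z i (g i))))) =
    (\<Sum>u\<in>Pow A. (- 1) ^ card u * (\<Sum>h\<in>PiE u (\<lambda>_. {..<n}). (\<Prod>i\<in>u. of_bool (g i \<le> h i)) * ?D h u F ?X)
      + (- 1) ^ card (insert i u) * (\<Sum>h\<in>PiE (insert i u) (\<lambda>_. {..<n}).
          (\<Prod>i\<in>insert i u. of_bool (g i \<le> h i)) * ?D h (insert i u) F ?X))"
  proof (intro sum.cong refl)
    fix u assume "u \<in> Pow A"
    then have u: "finite u" "u \<subseteq> A" "i \<notin> u" "\<And>j. j \<in> u \<Longrightarrow> i < j"
      using insert i finite_subset by auto
    \<comment> \<open>The value at \<open>g i\<close> is the value at the upper end \<open>n\<close>
      minus the increments from \<open>g i\<close> on. Each increment is a mixed difference over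
      \<open>insert i u\<close>, which accounts for the change of sign.\<close>
    have D: "?D h u F (?X(i := z i (g i))) =
      ?D h u F ?X - (\<Sum>k<n. of_bool (g i \<le> k) * ?D (h(i := k)) (insert i u) F ?X)" for h
    proof -
      have "?D (h(i := k)) (insert i u) F ?X = ?D h u F (?X(i := z i (Suc k))) - ?D h u F (?X(i := z i k))" for k
      proof -
        have "?D (h(i := k)) u F = ?D h u F"
          using u by (intro mixed_diff_cong) auto
        then show ?thesis
          using u by (simp add: mixed_diff_insert_min)
      qed
      moreover have "?X(i := z i n) = ?X" by auto
      ultimately show ?thesis
        using telescope_indicator[of "g i" n "\<lambda>k. ?D h u F (?X(i := z i k))"] insert.prems by simp
    qed
    have "(\<Prod>j\<in>u. of_bool (g j \<le> (h(i := k)) j)) = (\<Prod>j\<in>u. of_bool (g j \<le> h j) :: real)" for h k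
      using u by (intro prod.cong) auto
    then have "(\<Sum>h\<in>PiE (insert i u) (\<lambda>_. {..<n}). (\<Prod>i\<in>insert i u. of_bool (g i \<le> h i)) * ?D h (insert i u) F ?X)
      = (\<Sum>k<n. \<Sum>h\<in>PiE u (\<lambda>_. {..<n}). (\<Prod>i\<in>u. of_bool (g i \<le> h i)) *
          (of_bool (g i \<le> k) * ?D (h(i := k)) (insert i u) F ?X))"
      using u by (subst sum_PiE_insert) (simp_all add: mult_ac)
    also have "\<dots> = (\<Sum>h\<in>PiE u (\<lambda>_. {..<n}). (\<Prod>i\<in>u. of_bool (g i \<le> h i)) *
          (\<Sum>k<n. of_bool (g i \<le> k) * ?D (h(i := k)) (insert i u) F ?X))"
      by (subst sum.swap) (simp only: sum_distrib_left)
    finally show "(- 1) ^ card u * (\<Sum>h\<in>PiE u (\<lambda>_. {..<n}). (\<Prod>i\<in>u. of_bool (g i \<le> h i)) *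
        ?D h u F (?X(i := z i (g i)))) =
      (- 1) ^ card u * (\<Sum>h\<in>PiE u (\<lambda>_. {..<n}). (\<Prod>i\<in>u. of_bool (g i \<le> h i)) * ?D h u F ?X)
      + (- 1) ^ card (insert i u) * (\<Sum>h\<in>PiE (insert i u) (\<lambda>_. {..<n}).
          (\<Prod>i\<in>insert i u. of_bool (g i \<le> h i)) * ?D h (insert i u) F ?X)"
      using u unfolding D by (simp add: right_diff_distrib sum_subtractf)
  qed
  also have "\<dots> = (\<Sum>u\<in>Pow (insert i A). (- 1) ^ card u * (\<Sum>h\<in>PiE u (\<lambda>_. {..<n}).
      (\<Prod>i\<in>u. of_bool (g i \<le> h i)) * ?D h u F ?X))"
    using insert.hyps(1) i by (rule sum_Pow_insert[symmetric])
  finally show ?case .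
qed

subsection \<open>Distribution functions and quantiles\<close>

context
  fixes l r :: real and f :: "real \<Rightarrow> real"
  assumes density: "density_on l r f" and bij: "bij_betw (cdf_on l f) {l..r} {0..1}"
begin

lemma density_integrable_mult:
  assumes "A \<in> sets lebesgue" "A \<subseteq> {l..r}"
  shows "integrable (lebesgue_on {l..r}) (\<lambda>y. f y * indicator A y)"
  using integrable_real_mult_indicator[of A "lebesgue_on {l..r}" f] density assms
  by (simp add: density_on_def sets_restrict_space_iff)

text \<open>The integrals over different intervals are moved to one measure, where they can be
  compared.\<close>

lemma cdf_on_eq:
  assumes "w \<in> {l..r}"
  shows "cdf_on l f w = (LINT y|lebesgue_on {l..r}. f y * indicator {l..w} y)"
proof -
  have w: "{l..r} \<inter> {l..w} = {l..w}" using assms by auto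
  have "lebesgue_on {l..w} = restrict_space (lebesgue_on {l..r}) {l..w}"
    using restrict_restrict_space[of "{l..r}" lebesgue "{l..w}"] by (simp only: w) simp
  moreover have "{l..w} \<inter> space (lebesgue_on {l..r}) \<in> sets (lebesgue_on {l..r})"
    by (auto simp: sets_restrict_space)
  ultimately show ?thesis
    by (simp add: cdf_on_def integral_restrict_space mult.commute)
qed

text \<open>Nonnegativity of the density gives monotonicity, and injectivity makes it
  strict.\<close>

lemma cdf_on_strict_mono:
  assumes "v \<in> {l..r}" "w \<in> {l..r}" "v < w"
  shows "cdf_on l f v < cdf_on l f w"
proof -
  have "cdf_on l f v \<le> cdf_on l f w"
    unfolding cdf_on_eq[OF assms(1)] cdf_on_eq[OF assms(2)]
  proof (rule integral_mono)
    fix y assume "y \<in> space (lebesgue_on {l..r})"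
    then show "f y * indicator {l..v} y \<le> f y * indicator {l..w} y"
      using assms density by (auto simp: indicator_def density_on_def)
  qed (use assms in \<open>auto intro!: density_integrable_mult\<close>)
  moreover have "cdf_on l f v \<noteq> cdf_on l f w"
    using assms inj_onD[OF bij_betw_imp_inj_on[OF bij], of v w] by auto
  ultimately show ?thesis by simp
qed

lemma cdf_on_less_iff:
  assumes "v \<in> {l..r}" "w \<in> {l..r}"
  shows "cdf_on l f v < cdf_on l f w \<longleftrightarrow> v < w"
  using cdf_on_strict_mono[OF assms] cdf_on_strict_mono[OF assms(2,1)]
  by (cases v w rule: linorder_cases) auto

lemma quantile:
  assumes "\<zeta> \<in> {0..1}"
  shows "inv_into {l..r} (cdf_on l f) \<zeta> \<in> {l..r}" "cdf_on l f (inv_into {l..r} (cdf_on l f) \<zeta>) = \<zeta>"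
  using assms bij inv_into_into[of \<zeta> "cdf_on l f" "{l..r}"] f_inv_into_f[of \<zeta> "cdf_on l f" "{l..r}"]
  by (auto simp: bij_betw_def)

lemma cdf_on_in_unit: "y \<in> {l..r} \<Longrightarrow> cdf_on l f y \<in> {0..1}"
  using bij by (auto simp: bij_betw_def)

lemma quantile_mono:
  assumes "\<zeta> \<in> {0..1}" "\<eta> \<in> {0..1}" "\<zeta> \<le> \<eta>"
  shows "inv_into {l..r} (cdf_on l f) \<zeta> \<le> inv_into {l..r} (cdf_on l f) \<eta>"
  using cdf_on_less_iff[OF quantile(1)[OF assms(2)] quantile(1)[OF assms(1)]] quantile(2) assms by auto

text \<open>The distribution function makes a random variable with density \<open>f\<close> uniform:
  up to one point, the set in question is the interval from \<open>l\<close> to the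
  \<open>\<zeta>\<close>-quantile.\<close>

lemma has_integral_density_below:
  assumes "\<zeta> \<in> {0..1}"
  shows "has_bochner_integral (lebesgue_on {l..r}) (\<lambda>y. f y * of_bool (cdf_on l f y < \<zeta>)) \<zeta>"
proof -
  define w where "w = inv_into {l..r} (cdf_on l f) \<zeta>"
  have w: "w \<in> {l..r}" "cdf_on l f w = \<zeta>"
    using quantile[OF assms] by (auto simp: w_def)
  have "has_bochner_integral (lebesgue_on {l..r}) (\<lambda>y. f y * indicator {l..w} y) \<zeta>"
    using density_integrable_mult[of "{l..w}"] cdf_on_eq[OF w(1)] w
    by (simp add: has_bochner_integral_iff)
  moreover have "AE y in lebesgue_on {l..r}. f y * indicator {l..w} y = f y * of_bool (cdf_on l f y < \<zeta>)"
  proof -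
    have "AE y in lebesgue. y \<noteq> w"
      using AE_completion[OF AE_lborel_singleton[of w]] .
    then show ?thesis
      by (subst AE_restrict_space_iff)
        (auto elim!: eventually_mono simp: indicator_def w(2)[symmetric] cdf_on_less_iff[OF _ w(1)])
  qed
  moreover have "(\<lambda>y. f y * of_bool (cdf_on l f y < \<zeta>)) \<in> borel_measurable (lebesgue_on {l..r})"
  proof -
    have "(\<lambda>y. f y * indicator {l..<w} y) \<in> borel_measurable (lebesgue_on {l..r})"
      by (intro borel_measurable_integrable density_integrable_mult) (use w in auto)
    then show ?thesis
      by (rule measurable_cong[THEN iffD1, rotated])
        (auto simp: indicator_def w(2)[symmetric] cdf_on_less_iff[OF _ w(1)])
  qed
  ultimately show ?thesis
    using has_bochner_integral_cong_AE[of "\<lambda>y. f y * indicator {l..w} y" "lebesgue_on {l..r}"]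
    by (meson borel_measurable_has_bochner_integral)
qed

text \<open>Rounding the level \<open>cdf_on l f y\<close> down to a multiple of
  \<open>1 / Suc n\<close> moves it by less than \<open>1 / Suc n\<close>. The quantiles stay at or
  below \<open>y\<close>, and by strict monotonicity they eventually exceed every
  \<open>c < y\<close>.\<close>

lemma quantile_floor_tendsto:
  assumes "y \<in> {l..r}"
  shows "(\<lambda>n. inv_into {l..r} (cdf_on l f) (real (nat \<lfloor>real (Suc n) * cdf_on l f y\<rfloor>) / real (Suc n))) \<longlonglongrightarrow> y"
proof -
  define \<zeta> where "\<zeta> n = real (nat \<lfloor>real (Suc n) * cdf_on l f y\<rfloor>) / real (Suc n)" for n
  define q where "q n = inv_into {l..r} (cdf_on l f) (\<zeta> n)" for n
  have y: "0 \<le> cdf_on l f y" "cdf_on l f y \<le> 1"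
    using cdf_on_in_unit[OF assms] by auto
  have fl: "real (nat \<lfloor>real (Suc n) * cdf_on l f y\<rfloor>) = of_int \<lfloor>real (Suc n) * cdf_on l f y\<rfloor>" for n
    using y by simp
  have up: "\<zeta> n \<le> cdf_on l f y" for n
    unfolding \<zeta>_def fl by (simp add: pos_divide_le_eq del: of_nat_Suc) (metis mult.commute of_int_floor_le)
  have low: "cdf_on l f y - 1 / real (Suc n) < \<zeta> n" for n
  proof -
    have "real (Suc n) * cdf_on l f y - 1 < of_int \<lfloor>real (Suc n) * cdf_on l f y\<rfloor>"
      by linarith
    then have "(real (Suc n) * cdf_on l f y - 1) / real (Suc n) < \<zeta> n"
      unfolding \<zeta>_def fl by (intro divide_strict_right_mono) auto
    then show ?thesis
      by (simp add: diff_divide_distrib)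
  qed
  have unit: "\<zeta> n \<in> {0..1}" for n
  proof -
    have "0 \<le> \<zeta> n" by (simp add: \<zeta>_def)
    then show ?thesis using up[of n] y by auto
  qed
  have q: "q n \<in> {l..r}" "cdf_on l f (q n) = \<zeta> n" for n
    using quantile[OF unit] by (auto simp: q_def)
  have "q \<longlonglongrightarrow> y"
  proof (rule order_tendstoI)
    fix c assume "c < y"
    \<comment> \<open>\<open>c\<close> is raised to \<open>l\<close> if necessary, to stay where the
      distribution function is known to be strictly monotone.\<close>
    define v where "v = max c l"
    show "\<forall>\<^sub>F n in sequentially. c < q n"
    proof (cases "v < y")
      case False
      then have "y \<le> l" using \<open>c < y\<close> by (auto simp: v_def)
      then have "c < q n" for n using q(1)[of n] \<open>c < y\<close> by auto
      then show ?thesis by simp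
    next
      case True
      then have v: "v \<in> {l..r}" using assms by (auto simp: v_def)
      then have "cdf_on l f v < cdf_on l f y"
        using True assms cdf_on_strict_mono by auto
      moreover have "(\<lambda>n. cdf_on l f y - 1 / real (Suc n)) \<longlonglongrightarrow> cdf_on l f y - 0"
        by (intro tendsto_diff tendsto_const lim_inverse_n'[THEN LIMSEQ_Suc])
      ultimately have "\<forall>\<^sub>F n in sequentially. cdf_on l f v < cdf_on l f y - 1 / real (Suc n)"
        by (intro order_tendstoD) auto
      then show ?thesis
      proof (rule eventually_mono)
        fix n assume "cdf_on l f v < cdf_on l f y - 1 / real (Suc n)"
        then have "cdf_on l f v < cdf_on l f (q n)"
          using low[of n] q by simp
        then show "c < q n"
          using cdf_on_less_iff[OF v q(1)] by (simp add: v_def)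
      qed
    qed
  next
    fix c assume "y < c"
    have "q n \<le> y" for n
      using cdf_on_less_iff[OF assms q(1)[of n]] up[of n] q(2)[of n] by auto
    then show "\<forall>\<^sub>F n in sequentially. q n < c"
      using \<open>y < c\<close> by (intro always_eventually) (auto intro: le_less_trans)
  qed
  then show ?thesis
    by (simp add: q_def[abs_def] \<zeta>_def del: of_nat_Suc)
qed

end

text \<open>The coordinates of \<open>x\<close> are replaced by those of \<open>y\<close> one at a
  time, each replacement being controlled by the mean value theorem for a singleton
  \<open>{i}\<close>.\<close>

lemma mixed_partials_lipschitz:
  fixes F :: "(nat \<Rightarrow> real) \<Rightarrow> real" and a b x y :: "nat \<Rightarrow> real"
  assumes "finite I" and F: "has_mixed_partials I a b F"
    and B: "\<And>i x. i \<in> I \<Longrightarrow> x \<in> box_on I a b \<Longrightarrow> \<bar>mixed_partial a b {i} F x\<bar> \<le> B i"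
    and x: "x \<in> box_on I a b" and y: "y \<in> box_on I a b"
  shows "\<bar>F y - F x\<bar> \<le> (\<Sum>i\<in>I. B i * \<bar>y i - x i\<bar>)"
proof -
  define w where "w A = (\<lambda>i. if i \<in> A then y i else x i)" for A
  have w: "w A \<in> box_on I a b" if "A \<subseteq> I" for A
    using that x y by (auto simp: w_def box_on_def PiE_iff extensional_def)
  have "\<bar>F (w A) - F x\<bar> \<le> (\<Sum>i\<in>A. B i * \<bar>y i - x i\<bar>)" if "finite A" "A \<subseteq> I" for A
    using that
  proof (induction A rule: finite_induct)
    case empty
    then show ?case by (simp add: w_def)
  next
    case (insert i A)
    have i: "i \<in> I" "A \<subseteq> I" using insert by auto
    \<comment> \<open>\<open>mixed_diff_mvt\<close> expects ordered end points; the sign is lost in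
      the absolute value.\<close>
    define l where "l j = min (x j) (y j)" for j
    define r where "r j = max (x j) (y j)" for j
    have "a i \<le> x i \<and> x i \<le> b i" "a i \<le> y i \<and> y i \<le> b i"
      using i x y by (auto simp: box_on_def PiE_iff)
    then have "\<exists>v\<in>box_on I a b. mixed_diff l r {i} F (w A) = (\<Prod>j\<in>{i}. r j - l j) * mixed_partial a b {i} F v"
      using i by (intro mixed_diff_mvt F w) (auto simp: l_def r_def)
    then obtain v where v: "v \<in> box_on I a b" "mixed_diff l r {i} F (w A) = (r i - l i) * mixed_partial a b {i} F v"
      by auto
    have "F (w (insert i A)) - F (w A) = F ((w A)(i := y i)) - F ((w A)(i := x i))"
      using insert by (intro arg_cong2[of _ _ _ _ "(-)"] arg_cong[of _ _ F]) (auto simp: w_def)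
    also have "\<bar>\<dots>\<bar> = \<bar>mixed_diff l r {i} F (w A)\<bar>"
      by (cases "x i \<le> y i") (auto simp: mixed_diff_def coord_diff_def l_def r_def min_def max_def simp del: fun_upd_apply)
    also have "\<dots> = \<bar>y i - x i\<bar> * \<bar>mixed_partial a b {i} F v\<bar>"
      by (auto simp: v abs_mult l_def r_def)
    also have "\<dots> \<le> B i * \<bar>y i - x i\<bar>"
      by (subst mult.commute) (intro mult_right_mono B[OF i(1) v(1)] abs_ge_zero)
    finally have "\<bar>F (w (insert i A)) - F (w A)\<bar> \<le> B i * \<bar>y i - x i\<bar>" .
    then show ?case
      using insert i by auto
  qed
  from this[of I] assms(1) have "\<bar>F (w I) - F x\<bar> \<le> (\<Sum>i\<in>I. B i * \<bar>y i - x i\<bar>)" by simp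
  also have "w I = y"
    using x y by (auto simp: w_def box_on_def PiE_iff extensional_def)
  finally show ?thesis .
qed

subsection \<open>The Koksma-Hlawka inequality\<close>

locale quantile_box =
  fixes I :: "nat set" and a b :: "nat \<Rightarrow> real" and \<phi> :: "nat \<Rightarrow> real \<Rightarrow> real"
  assumes finite_I: "finite I"
    and density: "\<And>i. i \<in> I \<Longrightarrow> density_on (a i) (b i) (\<phi> i)"
    and bij: "\<And>i. i \<in> I \<Longrightarrow> bij_betw (cdf_on (a i) (\<phi> i)) {a i..b i} {0..1}"
begin

abbreviation "Box \<equiv> box_on I a b"
abbreviation "\<Phi> i \<equiv> cdf_on (a i) (\<phi> i)"
abbreviation "P \<equiv> \<Pi>\<^sub>M i\<in>I. lebesgue_on {a i..b i}"

text \<open>The grid is equidistant in the levels, where the points \<open>y\<close> live; its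
  spacing inside the box is whatever the densities make it. \<open>Suc n\<close> keeps the
  denominator positive.\<close>

definition grid :: "nat \<Rightarrow> nat \<Rightarrow> nat \<Rightarrow> real" where
  "grid n i j = inv_into {a i..b i} (\<Phi> i) (real j / real (Suc n))"

definition cell_index :: "nat \<Rightarrow> (nat \<Rightarrow> real) \<Rightarrow> nat \<Rightarrow> nat" where
  "cell_index n x i = nat \<lfloor>real (Suc n) * \<Phi> i (x i)\<rfloor>"

text \<open>Every coordinate is rounded down to the grid, which makes \<open>F (snap n x)\<close> a
  step function on the box.\<close>

definition snap :: "nat \<Rightarrow> (nat \<Rightarrow> real) \<Rightarrow> nat \<Rightarrow> real" where
  "snap n x i = (if i \<in> I then grid n i (cell_index n x i) else x i)"

lemma space_P: "space P = Box"
  by (simp add: space_PiM box_on_def)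

lemma box_D: "x \<in> Box \<Longrightarrow> i \<in> I \<Longrightarrow> x i \<in> {a i..b i}"
  by (auto simp: box_on_def PiE_iff)

lemma cell_index_le:
  assumes "x \<in> Box" "i \<in> I"
  shows "cell_index n x i \<le> Suc n"
proof -
  have "\<Phi> i (x i) \<le> 1"
    using cdf_on_in_unit[OF density bij, OF assms(2) assms(2) box_D[OF assms]] by simp
  then have "real (Suc n) * \<Phi> i (x i) \<le> real (Suc n)"
    by (intro mult_left_le) auto
  then show ?thesis
    unfolding cell_index_def by linarith
qed

text \<open>This turns the indicators of the summation by parts into those of boxes anchored at 0,
  as they occur in the discrepancy.\<close>

lemma cell_index_le_iff:
  assumes "x \<in> Box" "i \<in> I"
  shows "cell_index n x i \<le> h \<longleftrightarrow> \<Phi> i (x i) < real (Suc h) / real (Suc n)"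
proof -
  have "0 \<le> \<Phi> i (x i)"
    using cdf_on_in_unit[OF density bij, OF assms(2) assms(2) box_D[OF assms]] by simp
  then have "0 \<le> real (Suc n) * \<Phi> i (x i)"
    by simp
  then have "cell_index n x i \<le> h \<longleftrightarrow> real (Suc n) * \<Phi> i (x i) < real (Suc h)"
    unfolding cell_index_def by linarith
  also have "\<dots> \<longleftrightarrow> \<Phi> i (x i) < real (Suc h) / real (Suc n)"
    by (simp add: pos_less_divide_eq mult.commute del: of_nat_Suc)
  finally show ?thesis .
qed

lemma grid_in: "i \<in> I \<Longrightarrow> j \<le> Suc n \<Longrightarrow> grid n i j \<in> {a i..b i}"
  unfolding grid_def by (intro quantile density bij) (auto simp: divide_le_eq)

lemma grid_mono: "i \<in> I \<Longrightarrow> j < Suc n \<Longrightarrow> grid n i j \<le> grid n i (Suc j)"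
  unfolding grid_def by (intro quantile_mono[OF density bij]) (auto simp: divide_le_eq divide_right_mono)

lemma snap_in_box: "x \<in> Box \<Longrightarrow> snap n x \<in> Box"
  using grid_in[OF _ cell_index_le, of _ x] unfolding box_on_def
  by (auto simp: PiE_iff snap_def extensional_def)

lemma snap_tendsto:
  assumes "x \<in> Box" "i \<in> I"
  shows "(\<lambda>n. snap n x i) \<longlonglongrightarrow> x i"
  using quantile_floor_tendsto[OF density bij box_D] assms
  by (simp add: snap_def grid_def cell_index_def del: of_nat_Suc)

sublocale product_sigma_finite "\<lambda>i. lebesgue_on {a i..b i}"
  by (simp add: product_sigma_finite_def finite_measure.axioms(1) finite_measure_lebesgue_on)

lemma has_integral_box_below:
  assumes "u \<subseteq> I" "\<And>i. i \<in> u \<Longrightarrow> \<zeta> i \<in> {0..1}"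
  shows "has_bochner_integral P (\<lambda>x. (\<Prod>i\<in>u. of_bool (\<Phi> i (x i) < \<zeta> i)) * (\<Prod>i\<in>I. \<phi> i (x i))) (\<Prod>i\<in>u. \<zeta> i)"
proof -
  \<comment> \<open>The integral factorises, and coordinates outside \<open>u\<close> contribute the
    total mass 1.\<close>
  let ?f = "\<lambda>i y. if i \<in> u then \<phi> i y * of_bool (\<Phi> i y < \<zeta> i) else \<phi> i y"
  have f: "has_bochner_integral (lebesgue_on {a i..b i}) (?f i) (if i \<in> u then \<zeta> i else 1)" if "i \<in> I" for i
    using has_integral_density_below[OF density bij, OF that that] density[OF that] assms(2)
    by (auto simp: density_on_def has_bochner_integral_iff)
  have "has_bochner_integral P (\<lambda>x. \<Prod>i\<in>I. ?f i (x i)) (\<Prod>i\<in>I. if i \<in> u then \<zeta> i else 1)"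
    unfolding has_bochner_integral_iff
    using product_integrable_prod[OF finite_I, of ?f] product_integral_prod[OF finite_I, of ?f] f
    by (simp add: has_bochner_integral_iff)
  moreover have "(\<Prod>i\<in>I. if i \<in> u then \<zeta> i else 1) = (\<Prod>i\<in>u. \<zeta> i)"
    using assms(1) finite_I by (simp add: prod.If_cases Int_absorb1)
  moreover have "(\<Prod>i\<in>I. ?f i (x i)) = (\<Prod>i\<in>u. of_bool (\<Phi> i (x i) < \<zeta> i)) * (\<Prod>i\<in>I. \<phi> i (x i))" for x
  proof -
    have "(\<Prod>i\<in>I. ?f i (x i)) = (\<Prod>i\<in>I. (if i \<in> u then of_bool (\<Phi> i (x i) < \<zeta> i) else 1) * \<phi> i (x i))"
      by (intro prod.cong) auto
    then show ?thesis
      using assms(1) finite_I by (simp add: prod.distrib prod.If_cases Int_absorb1)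
  qed
  ultimately show ?thesis by simp
qed

text \<open>The anchor of the expansion; \<open>undefined\<close> outside \<open>I\<close> makes it
  extensional, hence a point of the box.\<close>

definition corner :: "nat \<Rightarrow> nat \<Rightarrow> real" where
  "corner n = (\<lambda>i. if i \<in> I then grid n i (Suc n) else undefined)"

lemma corner_in_box: "corner n \<in> Box"
  using grid_in by (auto simp: box_on_def PiE_iff corner_def extensional_def)

abbreviation cell_diff :: "nat \<Rightarrow> ((nat \<Rightarrow> real) \<Rightarrow> real) \<Rightarrow> nat set \<Rightarrow> (nat \<Rightarrow> nat) \<Rightarrow> real" where
  "cell_diff n F u h \<equiv> mixed_diff (\<lambda>i. grid n i (h i)) (\<lambda>i. grid n i (Suc (h i))) u F (corner n)"

text \<open>The coefficients \<open>cell_diff\<close> are independent of \<open>x\<close>. Averaging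
  over points and integrating therefore act on the indicators only, and their difference is a
  discrepancy.\<close>

lemma snap_expansion:
  assumes "x \<in> Box"
  shows "F (snap n x) = (\<Sum>u\<in>Pow I. (- 1) ^ card u * (\<Sum>h\<in>PiE u (\<lambda>_. {..<Suc n}).
    (\<Prod>i\<in>u. of_bool (\<Phi> i (x i) < real (Suc (h i)) / real (Suc n))) * cell_diff n F u h))"
proof -
  have "snap n x = (\<lambda>i. if i \<in> I then grid n i (cell_index n x i) else undefined)"
    using assms by (auto simp: snap_def box_on_def PiE_iff extensional_def)
  then have "F (snap n x) = F (\<lambda>i. if i \<in> I then grid n i (cell_index n x i) else (\<lambda>_. undefined) i)"
    by simp
  also have "\<dots> = (\<Sum>u\<in>Pow I. (- 1) ^ card u * (\<Sum>h\<in>PiE u (\<lambda>_. {..<Suc n}).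
    (\<Prod>i\<in>u. of_bool (cell_index n x i \<le> h i)) * cell_diff n F u h))"
    unfolding corner_def by (rule grid_expansion[OF finite_I cell_index_le[OF assms]])
  also have "\<dots> = (\<Sum>u\<in>Pow I. (- 1) ^ card u * (\<Sum>h\<in>PiE u (\<lambda>_. {..<Suc n}).
    (\<Prod>i\<in>u. of_bool (\<Phi> i (x i) < real (Suc (h i)) / real (Suc n))) * cell_diff n F u h))"
    using cell_index_le_iff[OF assms] by (intro sum.cong refl arg_cong2[of _ _ _ _ "(*)"] prod.cong) auto
  finally show ?thesis .
qed

lemma has_integral_snap:
  "has_bochner_integral P (\<lambda>x. F (snap n x) * (\<Prod>i\<in>I. \<phi> i (x i)))
    (\<Sum>u\<in>Pow I. (- 1) ^ card u * (\<Sum>h\<in>PiE u (\<lambda>_. {..<Suc n}).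
      (\<Prod>i\<in>u. real (Suc (h i)) / real (Suc n)) * cell_diff n F u h))"
proof -
  have "has_bochner_integral P (\<lambda>x. \<Sum>u\<in>Pow I. (- 1) ^ card u * (\<Sum>h\<in>PiE u (\<lambda>_. {..<Suc n}).
      ((\<Prod>i\<in>u. of_bool (\<Phi> i (x i) < real (Suc (h i)) / real (Suc n))) * (\<Prod>i\<in>I. \<phi> i (x i))) * cell_diff n F u h))
    (\<Sum>u\<in>Pow I. (- 1) ^ card u * (\<Sum>h\<in>PiE u (\<lambda>_. {..<Suc n}).
      (\<Prod>i\<in>u. real (Suc (h i)) / real (Suc n)) * cell_diff n F u h))"
    by (intro has_bochner_integral_sum has_bochner_integral_mult_right has_bochner_integral_mult_left has_integral_box_below)
      (auto simp: PiE_iff divide_le_eq simp del: of_nat_Suc)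
  then show ?thesis
    by (rule has_bochner_integral_cong[THEN iffD1, rotated -1])
      (simp_all add: space_P snap_expansion sum_distrib_right sum_distrib_left mult_ac del: of_nat_Suc)
qed

text \<open>A discrete variation of \<open>F\<close>: each difference is at most \<open>B\<close>
  times the volume of its cell, and summing over the cells gives a product of telescoping sums of
  side lengths.\<close>

lemma cell_diff_sum_le:
  assumes F: "has_mixed_partials I a b F" and u: "u \<subseteq> I"
    and B: "\<And>x. x \<in> Box \<Longrightarrow> \<bar>mixed_partial a b u F x\<bar> \<le> B"
  shows "(\<Sum>h\<in>PiE u (\<lambda>_. {..<Suc n}). \<bar>cell_diff n F u h\<bar>) \<le> B * (\<Prod>i\<in>u. b i - a i)"
proof -
  have fin: "finite u" using u finite_I finite_subset by auto
  have B0: "0 \<le> B"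
    using B[OF corner_in_box] abs_ge_zero order_trans by blast
  let ?l = "\<lambda>h i. grid n i (h i)" and ?r = "\<lambda>h i. grid n i (Suc (h i))"
  have "(\<Sum>h\<in>PiE u (\<lambda>_. {..<Suc n}). \<bar>cell_diff n F u h\<bar>) \<le>
    (\<Sum>h\<in>PiE u (\<lambda>_. {..<Suc n}). B * (\<Prod>i\<in>u. grid n i (Suc (h i)) - grid n i (h i)))"
  proof (rule sum_mono)
    fix h assume h: "h \<in> PiE u (\<lambda>_. {..<Suc n})"
    then have hi: "h i < Suc n" "i \<in> I" if "i \<in> u" for i
      using that u by (auto simp: PiE_iff)
    have lr: "a i \<le> ?l h i \<and> ?l h i \<le> ?r h i \<and> ?r h i \<le> b i" if "i \<in> u" for i
      using grid_in[OF hi(2)[OF that], of "h i" n] grid_in[OF hi(2)[OF that], of "Suc (h i)" n]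
        grid_mono[OF hi(2)[OF that]] hi(1)[OF that] by auto
    obtain y where y: "y \<in> Box"
      "cell_diff n F u h = (\<Prod>i\<in>u. ?r h i - ?l h i) * mixed_partial a b u F y"
      using mixed_diff_mvt[OF F fin u corner_in_box, of "?l h" "?r h" n] lr by blast
    have "0 \<le> (\<Prod>i\<in>u. ?r h i - ?l h i)"
      using lr by (intro prod_nonneg) auto
    then show "\<bar>cell_diff n F u h\<bar> \<le> B * (\<Prod>i\<in>u. ?r h i - ?l h i)"
      unfolding y(2) abs_mult by (subst mult.commute) (simp add: mult_right_mono B[OF y(1)])
  qed
  also have "\<dots> = B * (\<Prod>i\<in>u. \<Sum>j<Suc n. grid n i (Suc j) - grid n i j)"
    using fin by (subst prod_sum_PiE) (auto simp: sum_distrib_left)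
  also have "\<dots> = B * (\<Prod>i\<in>u. grid n i (Suc n) - grid n i 0)"
    by (simp only: sum_lessThan_telescope)
  also have "\<dots> \<le> B * (\<Prod>i\<in>u. b i - a i)"
  proof (intro mult_left_mono B0 prod_mono conjI)
    fix i assume "i \<in> u"
    then have i: "i \<in> I" using u by auto
    have "grid n i 0 \<le> grid n i (Suc n)"
      unfolding grid_def using i by (intro quantile_mono[OF density bij]) auto
    then show "0 \<le> grid n i (Suc n) - grid n i 0" by simp
    show "grid n i (Suc n) - grid n i 0 \<le> b i - a i"
      using grid_in[OF i, of 0 n] grid_in[OF i, of "Suc n" n] by simp
  qed
  finally show ?thesis .
qed

section \<open>Passage to the limit of fine grids\<close>

context
  fixes F :: "(nat \<Rightarrow> real) \<Rightarrow> real" and B :: "nat set \<Rightarrow> real"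
  assumes F: "has_mixed_partials I a b F"
    and B: "\<And>u x. u \<subseteq> I \<Longrightarrow> x \<in> Box \<Longrightarrow> \<bar>mixed_partial a b u F x\<bar> \<le> B u"
begin

lemma F_snap_tendsto:
  assumes x: "x \<in> Box"
  shows "(\<lambda>n. F (snap n x)) \<longlonglongrightarrow> F x"
proof -
  have le: "norm (F (snap n x) - F x) \<le> (\<Sum>i\<in>I. B {i} * \<bar>snap n x i - x i\<bar>)" for n
    unfolding real_norm_def by (rule mixed_partials_lipschitz[OF finite_I F B x snap_in_box[OF x]]) auto
  have "(\<lambda>n. \<Sum>i\<in>I. B {i} * \<bar>snap n x i - x i\<bar>) \<longlonglongrightarrow> (\<Sum>i\<in>I. B {i} * \<bar>x i - x i\<bar>)"
    by (intro tendsto_intros snap_tendsto x)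
  then have "(\<lambda>n. F (snap n x) - F x) \<longlonglongrightarrow> 0"
    by (intro Lim_null_comparison[OF always_eventually[OF allI[OF le]]]) simp
  then show ?thesis
    by (rule LIM_zero_cancel)
qed

text \<open>Dominated convergence with \<open>B {}\<close> times the density as majorant. The limit
  function is measurable as a pointwise limit of the snapped ones.\<close>

lemma integral_snap_tendsto:
  "(\<lambda>n. LINT x|P. F (snap n x) * (\<Prod>i\<in>I. \<phi> i (x i))) \<longlonglongrightarrow> (LINT x|P. F x * (\<Prod>i\<in>I. \<phi> i (x i)))"
proof -
  have lim: "(\<lambda>n. F (snap n x) * (\<Prod>i\<in>I. \<phi> i (x i))) \<longlonglongrightarrow> F x * (\<Prod>i\<in>I. \<phi> i (x i))" if "x \<in> space P" for x
    using that by (intro tendsto_intros F_snap_tendsto) (simp add: space_P)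
  have meas: "(\<lambda>x. F (snap n x) * (\<Prod>i\<in>I. \<phi> i (x i))) \<in> borel_measurable P" for n
    using has_integral_snap by (rule borel_measurable_has_bochner_integral)
  show ?thesis
  proof (rule integral_dominated_convergence)
    show "(\<lambda>x. F x * (\<Prod>i\<in>I. \<phi> i (x i))) \<in> borel_measurable P"
      using meas lim by (rule borel_measurable_LIMSEQ_real[rotated])
    show "integrable P (\<lambda>x. B {} * (\<Prod>i\<in>I. \<phi> i (x i)))"
      using has_integral_box_below[of "{}"] by (intro integrable_mult_right) (simp add: has_bochner_integral_iff)
    show "AE x in P. norm (F (snap n x) * (\<Prod>i\<in>I. \<phi> i (x i))) \<le> B {} * (\<Prod>i\<in>I. \<phi> i (x i))" for n
    proof (rule AE_I2)
      fix x assume "x \<in> space P"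
      then have x: "x \<in> Box" by (simp add: space_P)
      have "0 \<le> (\<Prod>i\<in>I. \<phi> i (x i))"
        using density box_D[OF x] by (intro prod_nonneg) (auto simp: density_on_def)
      moreover have "\<bar>F (snap n x)\<bar> \<le> B {}"
        using B[of "{}", OF _ snap_in_box[OF x]] by (simp add: mixed_partial_def)
      ultimately show "norm (F (snap n x) * (\<Prod>i\<in>I. \<phi> i (x i))) \<le> B {} * (\<Prod>i\<in>I. \<phi> i (x i))"
        by (simp add: abs_mult mult_right_mono)
    qed
  qed (use meas lim in auto)
qed

text \<open>For the snapped function, average and integral have the same expansion, so the error is
  a sum of discrepancies weighted with \<open>cell_diff\<close>. The resulting bound does not depend
  on \<open>n\<close> and survives the limit.\<close>

lemma quad_err_le:
  fixes y :: "nat \<Rightarrow> nat \<Rightarrow> real" and D :: "nat set \<Rightarrow> real"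
  assumes N: "0 < N" and y: "\<And>k i. k < N \<Longrightarrow> i \<in> I \<Longrightarrow> y k i \<in> {0..1}"
    and D: "\<And>u \<zeta>. u \<subseteq> I \<Longrightarrow> u \<noteq> {} \<Longrightarrow> (\<And>i. i \<in> u \<Longrightarrow> 0 \<le> \<zeta> i \<and> \<zeta> i \<le> 1) \<Longrightarrow>
      \<bar>box_disc u {..<N} y (\<lambda>_. 0) \<zeta>\<bar> \<le> D u"
  shows "\<bar>quad_err I a b \<phi> y N F\<bar> \<le> (\<Sum>u\<in>Pow I - {{}}. D u * (B u * (\<Prod>i\<in>u. b i - a i))) / N"
proof -
  define X where "X k = inv_cdf_map I a b \<phi> (y k)" for k
  have X: "X k \<in> Box" if "k < N" for k
    using quantile(1)[OF density bij] y[OF that] by (auto simp: X_def inv_cdf_map_def box_on_def)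
  have PhiX: "\<Phi> i (X k i) = y k i" if "k < N" "i \<in> I" for k i
    using quantile(2)[OF density bij, OF that(2) that(2) y[OF that]] that by (simp add: X_def inv_cdf_map_def)
  define err where "err n = (1 / real N) * (\<Sum>k<N. F (snap n (X k))) -
    (LINT x|P. F (snap n x) * (\<Prod>i\<in>I. \<phi> i (x i)))" for n
  let ?z = "\<lambda>n h i. real (Suc (h i)) / real (Suc n)"
  have err_eq: "err n = (\<Sum>u\<in>Pow I. (- 1) ^ card u * (\<Sum>h\<in>PiE u (\<lambda>_. {..<Suc n}).
      box_disc u {..<N} y (\<lambda>_. 0) (?z n h) * cell_diff n F u h)) / N" for n
  proof -
    have "(\<Sum>k<N. F (snap n (X k))) = (\<Sum>k<N. \<Sum>u\<in>Pow I. (- 1) ^ card u * (\<Sum>h\<in>PiE u (\<lambda>_. {..<Suc n}).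
      (\<Prod>i\<in>u. of_bool (0 \<le> y k i \<and> y k i < ?z n h i)) * cell_diff n F u h))"
    proof (rule sum.cong[OF refl])
      fix k assume k: "k \<in> {..<N}"
      then have "(\<Prod>i\<in>u. of_bool (\<Phi> i (X k i) < ?z n h i)) = (\<Prod>i\<in>u. of_bool (0 \<le> y k i \<and> y k i < ?z n h i) :: real)"
        if "u \<subseteq> I" for u h
        using that y[of k] by (intro prod.cong) (auto simp: PhiX subset_iff)
      then show "F (snap n (X k)) = (\<Sum>u\<in>Pow I. (- 1) ^ card u * (\<Sum>h\<in>PiE u (\<lambda>_. {..<Suc n}).
        (\<Prod>i\<in>u. of_bool (0 \<le> y k i \<and> y k i < ?z n h i)) * cell_diff n F u h))"
        using snap_expansion[OF X, of k F n] k by (simp del: of_nat_Suc)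
    qed
    also have "\<dots> = (\<Sum>u\<in>Pow I. (- 1) ^ card u * (\<Sum>h\<in>PiE u (\<lambda>_. {..<Suc n}).
      (\<Sum>k<N. \<Prod>i\<in>u. of_bool (0 \<le> y k i \<and> y k i < ?z n h i)) * cell_diff n F u h))"
      by (simp only: sum.swap[of _ _ "{..<N}"] sum_distrib_left[symmetric] sum_distrib_right[symmetric])
    finally have "(\<Sum>k<N. F (snap n (X k))) - N * (LINT x|P. F (snap n x) * (\<Prod>i\<in>I. \<phi> i (x i))) =
      (\<Sum>u\<in>Pow I. (- 1) ^ card u * (\<Sum>h\<in>PiE u (\<lambda>_. {..<Suc n}).
        box_disc u {..<N} y (\<lambda>_. 0) (?z n h) * cell_diff n F u h))"
      unfolding has_bochner_integral_integral_eq[OF has_integral_snap] box_disc_def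
      by (simp add: sum_distrib_left sum_subtractf algebra_simps del: of_nat_Suc sum.lessThan_Suc)
    then show ?thesis
      using N by (simp add: err_def field_simps)
  qed
  have bound: "\<bar>err n\<bar> \<le> (\<Sum>u\<in>Pow I - {{}}. D u * (B u * (\<Prod>i\<in>u. b i - a i))) / N" for n
  proof -
    have "\<bar>\<Sum>u\<in>Pow I. (- 1) ^ card u * (\<Sum>h\<in>PiE u (\<lambda>_. {..<Suc n}).
        box_disc u {..<N} y (\<lambda>_. 0) (?z n h) * cell_diff n F u h)\<bar> \<le>
      (\<Sum>u\<in>Pow I. if u = {} then 0 else D u * (B u * (\<Prod>i\<in>u. b i - a i)))"
    proof (rule sum_abs[THEN order_trans], rule sum_mono)
      fix u assume u: "u \<in> Pow I"
      show "\<bar>(- 1) ^ card u * (\<Sum>h\<in>PiE u (\<lambda>_. {..<Suc n}).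
          box_disc u {..<N} y (\<lambda>_. 0) (?z n h) * cell_diff n F u h)\<bar>
        \<le> (if u = {} then 0 else D u * (B u * (\<Prod>i\<in>u. b i - a i)))"
      proof (cases "u = {}")
        case True
        \<comment> \<open>Empty products are 1, so the discrepancy is \<open>N - N\<close>.\<close>
        then show ?thesis by (simp add: box_disc_def)
      next
        case False
        have "\<bar>(- 1) ^ card u * (\<Sum>h\<in>PiE u (\<lambda>_. {..<Suc n}).
          box_disc u {..<N} y (\<lambda>_. 0) (?z n h) * cell_diff n F u h)\<bar>
          \<le> (\<Sum>h\<in>PiE u (\<lambda>_. {..<Suc n}). \<bar>box_disc u {..<N} y (\<lambda>_. 0) (?z n h) * cell_diff n F u h\<bar>)"
          unfolding abs_mult[of "(- 1) ^ card u"] power_abs by (simp only: abs_minus power_one abs_one mult_1) (rule sum_abs)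
        also have "\<dots> \<le> (\<Sum>h\<in>PiE u (\<lambda>_. {..<Suc n}). D u * \<bar>cell_diff n F u h\<bar>)"
        proof (rule sum_mono)
          fix h assume "h \<in> PiE u (\<lambda>_. {..<Suc n})"
          then have "0 \<le> ?z n h i \<and> ?z n h i \<le> 1" if "i \<in> u" for i
            using that by (auto simp: PiE_iff divide_le_eq simp del: of_nat_Suc)
          then show "\<bar>box_disc u {..<N} y (\<lambda>_. 0) (?z n h) * cell_diff n F u h\<bar> \<le> D u * \<bar>cell_diff n F u h\<bar>"
            using D[OF _ False, of "?z n h"] u by (auto simp: abs_mult mult_right_mono simp del: of_nat_Suc)
        qed
        also have "\<dots> = D u * (\<Sum>h\<in>PiE u (\<lambda>_. {..<Suc n}). \<bar>cell_diff n F u h\<bar>)"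
          by (simp only: sum_distrib_left)
        also have "\<dots> \<le> D u * (B u * (\<Prod>i\<in>u. b i - a i))"
        proof (rule mult_left_mono)
          \<comment> \<open>\<open>D u\<close> bounds an absolute value, for instance at
            \<open>\<zeta> = 0\<close>.\<close>
          show "0 \<le> D u"
            using D[OF _ False, of "\<lambda>_. 0"] u by force
        qed (use u in \<open>intro cell_diff_sum_le F B\<close>, auto)
        finally show ?thesis using False by simp
      qed
    qed
    also have "\<dots> = (\<Sum>u\<in>Pow I - {{}}. D u * (B u * (\<Prod>i\<in>u. b i - a i)))"
      using finite_I by (intro sum.mono_neutral_cong_right) auto
    finally show ?thesis
      unfolding err_eq using N by (simp add: divide_right_mono del: of_nat_Suc)
  qed
  have "err \<longlonglongrightarrow> (1 / real N) * (\<Sum>k<N. F (X k)) - (LINT x|P. F x * (\<Prod>i\<in>I. \<phi> i (x i)))"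
    unfolding err_def by (intro tendsto_intros F_snap_tendsto integral_snap_tendsto X) auto
  then have "err \<longlonglongrightarrow> quad_err I a b \<phi> y N F"
    by (simp add: quad_err_def X_def)
  then have "(\<lambda>n. \<bar>err n\<bar>) \<longlonglongrightarrow> \<bar>quad_err I a b \<phi> y N F\<bar>"
    by (rule tendsto_rabs)
  then show ?thesis
    by (rule LIMSEQ_le_const2) (use bound in blast)
qed

end

end

subsection \<open>Hoelder's inequality and the worst-case error\<close>

lemma lp_norm_on_nonneg:
  assumes "finite A" "A \<noteq> {}"
  shows "0 \<le> lp_norm_on p A c"
  using assms by (auto simp: lp_norm_on_def Max_ge_iff)

text \<open>This removes the empty set from the norm of \<open>F\<close>, because the error bound
  has no term for it.\<close>

lemma lp_norm_on_mono_set: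
  assumes "finite A" "A' \<subseteq> A" "A' \<noteq> {}" "1 \<le> p"
  shows "lp_norm_on p A' c \<le> lp_norm_on p A c"
proof (cases p)
  case (real r)
  have "0 \<le> (\<Sum>u\<in>A'. \<bar>c u\<bar> powr r)"
    by (intro sum_nonneg) auto
  moreover have "(\<Sum>u\<in>A'. \<bar>c u\<bar> powr r) \<le> (\<Sum>u\<in>A. \<bar>c u\<bar> powr r)"
    using assms by (intro sum_mono2) auto
  ultimately show ?thesis
    using assms(4) real by (auto simp: lp_norm_on_def intro!: powr_mono2)
qed (use assms in \<open>auto simp: lp_norm_on_def intro!: Max_mono\<close>)

text \<open>Both families are scaled to norm 1, where Young's inequality is summed termwise. A
  family of norm 0 cannot be scaled, but then all products vanish.\<close>

lemma Holder_inequality_sum: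
  fixes c d :: "'a \<Rightarrow> real"
  assumes "finite A" and pq: "1 < p" "1 < q" "1 / p + 1 / q = 1"
    and c: "\<And>u. u \<in> A \<Longrightarrow> 0 \<le> c u" and d: "\<And>u. u \<in> A \<Longrightarrow> 0 \<le> d u"
  shows "(\<Sum>u\<in>A. c u * d u) \<le> (\<Sum>u\<in>A. c u powr p) powr (1 / p) * (\<Sum>u\<in>A. d u powr q) powr (1 / q)"
proof -
  define \<alpha> where "\<alpha> = (\<Sum>u\<in>A. c u powr p) powr (1 / p)"
  define \<beta> where "\<beta> = (\<Sum>u\<in>A. d u powr q) powr (1 / q)"
  have S: "0 \<le> (\<Sum>u\<in>A. c u powr p)" and T: "0 \<le> (\<Sum>u\<in>A. d u powr q)"
    by (auto intro: sum_nonneg)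
  show ?thesis
  proof (cases "\<alpha> = 0 \<or> \<beta> = 0")
    case True
    then have "(\<Sum>u\<in>A. c u powr p) = 0 \<or> (\<Sum>u\<in>A. d u powr q) = 0"
      by (auto simp: \<alpha>_def \<beta>_def)
    then have "\<forall>u\<in>A. c u * d u = 0"
      using assms(1) by (auto simp: sum_nonneg_eq_0_iff)
    then have "(\<Sum>u\<in>A. c u * d u) = 0"
      by (rule sum.neutral)
    then show ?thesis by simp
  next
    case False
    have pos: "0 < \<alpha>" "0 < \<beta>"
      using False by (auto simp: \<alpha>_def \<beta>_def less_le)
    have pow: "\<alpha> powr p = (\<Sum>u\<in>A. c u powr p)" "\<beta> powr q = (\<Sum>u\<in>A. d u powr q)"
      using pq S T by (auto simp: \<alpha>_def \<beta>_def powr_powr)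
    have "(\<Sum>u\<in>A. c u * d u) / (\<alpha> * \<beta>) = (\<Sum>u\<in>A. (c u / \<alpha>) * (d u / \<beta>))"
      by (simp add: sum_divide_distrib)
    also have "\<dots> \<le> (\<Sum>u\<in>A. (c u / \<alpha>) powr p / p + (d u / \<beta>) powr q / q)"
      using pq c d pos by (intro sum_mono Youngs_inequality) auto
    also have "\<dots> = (\<Sum>u\<in>A. c u powr p / \<alpha> powr p / p + d u powr q / \<beta> powr q / q)"
      using c d pos by (intro sum.cong) (auto simp: powr_divide)
    also have "\<dots> = 1 / p + 1 / q"
    proof -
      have "\<alpha> powr p \<noteq> 0" "\<beta> powr q \<noteq> 0" using pos by auto
      then show ?thesis
        unfolding sum.distrib sum_divide_distrib[symmetric] pow by simp
    qed
    finally show ?thesis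
      using pos pq(3) by (simp add: \<alpha>_def[symmetric] \<beta>_def[symmetric] divide_le_eq)
  qed
qed

lemma lp_norm_on_one: "lp_norm_on 1 A c = (\<Sum>u\<in>A. \<bar>c u\<bar>)"
proof -
  have "0 \<le> (\<Sum>u\<in>A. \<bar>c u\<bar>)" by (intro sum_nonneg) auto
  then show ?thesis by (simp add: lp_norm_on_def)
qed

lemma sum_mult_le_lp_norm_on_infinity:
  assumes "finite A"
  shows "(\<Sum>u\<in>A. c u * d u) \<le> lp_norm_on \<infinity> A c * lp_norm_on 1 A d"
proof -
  have "(\<Sum>u\<in>A. c u * d u) \<le> (\<Sum>u\<in>A. lp_norm_on \<infinity> A c * \<bar>d u\<bar>)"
  proof (rule sum_mono)
    fix u assume "u \<in> A"
    then have "\<bar>c u\<bar> \<le> lp_norm_on \<infinity> A c"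
      using assms by (simp add: lp_norm_on_def)
    then have "\<bar>c u\<bar> * \<bar>d u\<bar> \<le> lp_norm_on \<infinity> A c * \<bar>d u\<bar>"
      by (intro mult_right_mono) auto
    then show "c u * d u \<le> lp_norm_on \<infinity> A c * \<bar>d u\<bar>"
      by (metis abs_ge_self abs_mult order_trans)
  qed
  then show ?thesis
    by (simp add: lp_norm_on_one sum_distrib_left)
qed

lemma lp_norm_on_Holder:
  fixes c d :: "'a \<Rightarrow> real" and p q :: ereal
  assumes A: "finite A" and pq: "1 \<le> p" "1 \<le> q" "1 / p + 1 / q = 1"
    and c: "\<And>u. u \<in> A \<Longrightarrow> 0 \<le> c u" and d: "\<And>u. u \<in> A \<Longrightarrow> 0 \<le> d u"
  shows "(\<Sum>u\<in>A. c u * d u) \<le> lp_norm_on p A c * lp_norm_on q A d"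
proof -
  consider (pinf) "p = \<infinity>" | (qinf) "q = \<infinity>" | (real) p' q' where "p = ereal p'" "q = ereal q'"
    using pq(1,2) by (cases p; cases q) auto
  then show ?thesis
  proof cases
    case pinf
    \<comment> \<open>\<open>1 / \<infinity> = 0\<close> leaves \<open>1 / q = 1\<close>.\<close>
    then have "q = 1"
      using pq by (cases q) (auto simp: one_ereal_def)
    then show ?thesis
      using pinf sum_mult_le_lp_norm_on_infinity[OF A] by simp
  next
    case qinf
    then have "p = 1"
      using pq by (cases p) (auto simp: one_ereal_def)
    then show ?thesis
      using qinf sum_mult_le_lp_norm_on_infinity[OF A, of d c] by (simp add: mult.commute)
  next
    case real
    then have 1: "1 \<le> p'" "1 \<le> q'" "1 / p' + 1 / q' = 1"
      using pq by (auto simp: one_ereal_def)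
    \<comment> \<open>An exponent equal to 1 would make the reciprocal of the other one 0,
      impossible for a finite exponent.\<close>
    then have 2: "1 < p'" "1 < q'"
      by (auto simp: less_le)
    have "(\<Sum>u\<in>A. \<bar>c u\<bar> powr p') = (\<Sum>u\<in>A. c u powr p')" "(\<Sum>u\<in>A. \<bar>d u\<bar> powr q') = (\<Sum>u\<in>A. d u powr q')"
      using c d by (auto intro!: sum.cong)
    then show ?thesis
      using Holder_inequality_sum[OF A 2 1(3) c d] real by (simp add: lp_norm_on_def)
  qed
qed

theorem theorem3:
  fixes s N :: nat
    and a b :: "nat \<Rightarrow> real"
    and \<phi> :: "nat \<Rightarrow> real \<Rightarrow> real"
    and \<gamma> :: "nat set \<Rightarrow> real"
    and p q :: ereal
    and t :: "nat set \<Rightarrow> nat"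
    and C :: "nat \<Rightarrow> nat \<Rightarrow> nat \<Rightarrow> bit"
    and x :: "nat \<Rightarrow> nat \<Rightarrow> real"
  assumes "1 \<le> s"
    and "\<And>i. i \<in> {1..s} \<Longrightarrow> a i < b i"
    and "\<And>i. i \<in> {1..s} \<Longrightarrow> density_on (a i) (b i) (\<phi> i)"
    and "\<And>i. i \<in> {1..s} \<Longrightarrow> bij_betw (cdf_on (a i) (\<phi> i)) {a i..b i} {0..1}"
    and "\<And>u. u \<subseteq> {1..s} \<Longrightarrow> 0 < \<gamma> u"
    and "1 \<le> p" and "1 \<le> q" and "1 / p + 1 / q = 1"
    and "digital_sequence_family {1..s} t C x"
    and "\<And>i. i \<in> {1..s} \<Longrightarrow> nonsingular_upper_triangular (C i)"
    and "2 \<le> N"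
  shows "wce x N p {1..s} \<gamma> a b \<phi> \<le>
    ereal (1 / real N * (3 * ln (2 * real N) / ln 2) *
      lp_norm_on q {u. u \<subseteq> {1..s} \<and> u \<noteq> {}}
        (\<lambda>u. \<gamma> u * 2 ^ t u * (3 * ln (real N)) ^ card u * (\<Prod>i\<in>u. b i - a i)))"
proof -
  let ?I = "{1..s}"
  interpret quantile_box ?I a b \<phi>
    by standard (use assms(3,4) in auto)
  \<comment> \<open>\<open>K * E u\<close> will bound the discrepancy in the coordinates
    \<open>u\<close>, and \<open>d u\<close> is \<open>\<gamma> u * E u\<close> times the side
    lengths.\<close>
  define K where "K = 3 * ln (2 * real N) / ln 2"
  define E where "E u = 2 ^ t u * (3 * ln (real N)) ^ card u" for u
  define d where "d u = \<gamma> u * 2 ^ t u * (3 * ln (real N)) ^ card u * (\<Prod>i\<in>u. b i - a i)" for u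
  have A: "{u. u \<subseteq> ?I \<and> u \<noteq> {}} = Pow ?I - {{}}"
    by auto
  have nonempty: "Pow ?I - {{}} \<noteq> {}"
    using assms(1) by force
  have K: "0 \<le> K"
    using assms(11) by (simp add: K_def)
  have d: "0 \<le> d u" if "u \<in> Pow ?I - {{}}" for u
  proof -
    have "0 \<le> (\<Prod>i\<in>u. b i - a i)"
      using that less_imp_le[OF assms(2)] by (intro prod_nonneg) (simp add: subset_iff)
    then show ?thesis
      using that assms(5)[of u] assms(11) by (simp add: d_def)
  qed
  have seq: "digital_sequence u (t u) C (\<lambda>n. restrict (x n) u)" if "u \<subseteq> ?I" "u \<noteq> {}" for u
    using that assms(9) unfolding digital_sequence_family_def by blast
  have disc: "\<bar>box_disc u {..<N} x (\<lambda>_. 0) \<zeta>\<bar> \<le> K * E u"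
    if "u \<subseteq> ?I" "u \<noteq> {}" "\<And>i. i \<in> u \<Longrightarrow> 0 \<le> \<zeta> i \<and> \<zeta> i \<le> 1" for u \<zeta>
  proof -
    have "box_disc u {..<N} x (\<lambda>_. 0) \<zeta> = box_disc u {..<N} (\<lambda>n. restrict (x n) u) (\<lambda>_. 0) \<zeta>"
      by (rule box_disc_cong) auto
    then show ?thesis
      using digital_sequence_disc[OF finite_subset[OF that(1)] that(2) seq[OF that(1,2)] that(3) assms(11)]
      by (simp add: K_def E_def)
  qed
  have x: "x k i \<in> {0..1}" if "i \<in> ?I" for k i
  proof -
    \<comment> \<open>The singleton \<open>{i}\<close> of the family supplies this.\<close>
    have "column_finite (C i)"
      using seq[of "{i}"] that by (simp add: digital_sequence_def)
    moreover have "x k i = digital_coord (C i) k"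
      using assms(9) that by (simp add: digital_sequence_family_def digital_points_def)
    ultimately show ?thesis
      using digital_coord_bounds[of "C i" k] by simp
  qed
  have "\<bar>quad_err ?I a b \<phi> x N F\<bar> \<le> 1 / real N * K * lp_norm_on q (Pow ?I - {{}}) d"
    if F: "has_mixed_partials ?I a b F" "mixed_norm p ?I \<gamma> a b F \<le> 1" for F
  proof -
    define B where "B u = (SUP y\<in>box_on ?I a b. \<bar>mixed_partial a b u F y\<bar>)" for u
    define c where "c u = (1 / \<gamma> u) * B u" for u
    \<comment> \<open>A norm of at most 1 excludes the branch \<open>\<infinity>\<close>, so the
      suprema \<open>B u\<close> are those of bounded functions.\<close>
    have bdd: "\<forall>u\<subseteq>?I. bdd_above ((\<lambda>y. \<bar>mixed_partial a b u F y\<bar>) ` box_on ?I a b)"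
      and norm: "lp_norm_on p (Pow ?I) c \<le> 1"
      using F(2) by (auto simp: mixed_norm_def c_def[abs_def] B_def one_ereal_def split: if_splits)
    have B: "\<bar>mixed_partial a b u F y\<bar> \<le> B u" if "u \<subseteq> ?I" "y \<in> box_on ?I a b" for u y
      unfolding B_def using that bdd by (intro cSUP_upper) auto
    have B0: "0 \<le> B u" if "u \<subseteq> ?I" for u
      using B[OF that corner_in_box] abs_ge_zero order_trans by blast
    have "\<bar>quad_err ?I a b \<phi> x N F\<bar> \<le> (\<Sum>u\<in>Pow ?I - {{}}. K * E u * (B u * (\<Prod>i\<in>u. b i - a i))) / N"
      using assms(11) x disc by (intro quad_err_le F B) auto
    also have "\<dots> = 1 / real N * K * (\<Sum>u\<in>Pow ?I - {{}}. c u * d u)"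
    proof -
      \<comment> \<open>The weight enters \<open>c u\<close> inverted and \<open>d u\<close>
        directly, and cancels.\<close>
      have "K * E u * (B u * (\<Prod>i\<in>u. b i - a i)) = K * (c u * d u)" if "u \<in> Pow ?I - {{}}" for u
        using assms(5)[of u] that by (simp add: c_def d_def E_def)
      then have "(\<Sum>u\<in>Pow ?I - {{}}. K * E u * (B u * (\<Prod>i\<in>u. b i - a i))) = (\<Sum>u\<in>Pow ?I - {{}}. K * (c u * d u))"
        by (intro sum.cong refl)
      then show ?thesis
        by (simp add: sum_distrib_left[symmetric])
    qed
    also have "\<dots> \<le> 1 / real N * K * lp_norm_on q (Pow ?I - {{}}) d"
    proof (rule mult_left_mono)
      have "(\<Sum>u\<in>Pow ?I - {{}}. c u * d u) \<le> lp_norm_on p (Pow ?I - {{}}) c * lp_norm_on q (Pow ?I - {{}}) d"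
        using assms(5) B0 by (intro lp_norm_on_Holder assms d) (auto simp: c_def less_imp_le)
      also have "\<dots> \<le> 1 * lp_norm_on q (Pow ?I - {{}}) d"
        using lp_norm_on_mono_set[of "Pow ?I" "Pow ?I - {{}}" p c] nonempty assms(6) norm
        by (intro mult_right_mono lp_norm_on_nonneg) auto
      finally show "(\<Sum>u\<in>Pow ?I - {{}}. c u * d u) \<le> lp_norm_on q (Pow ?I - {{}}) d"
        by simp
    qed (use K in simp)
    finally show ?thesis .
  qed
  then show ?thesis
    unfolding wce_def A K_def d_def[abs_def] by (intro SUP_least) auto
qed

end
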